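(* Let $N\ge 3$, $1<p<\frac{N+2}{N-2}$ and $q=\frac{2p}{p+1}$. Then there exists $\epsilon_0>0$ depending on $N$ and $p$ such that for any $M\in\mathbb{R}$ satisfying $|M|\le\epsilon_0$, any $R>0$ and any positive solution $u$ of $$-\Delta u=|u|^{p-1}u+M|\nabla u|^q \qquad(\ast)$$ in $B_R\setminus\{0\}$, there holds $$u(x)\le c_{N,p}\,|x|^{-\frac{2}{p-1}}\qquad\text{for all }x\in B_{\frac R2}\setminus\{0\},$$ where $c_{N,p}>0$ depends only on $N$ and $p$. As a consequence, for $|M|\le\epsilon_0$ there exists no positive solution of $(\ast)$ in $\mathbb{R}^N$, and any positive solution $u$ of $(\ast)$ in a domain $\Omega\subset\mathbb{R}^N$ satisfies $$u(x)+|\nabla u(x)|^{\frac{2}{p+1}}\le c'_{N,p}\big(\mathrm{dist}(x,\partial\Omega)\big)^{-\frac{2}{p-1}}\qquad\text{for all }x\in\Omega,$$ where $c'_{N,p}>0$ depends only on $N$ and $p$.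
   Context: $B_R$ denotes the open ball of radius $R$ centered at $0$ in $\mathbb{R}^N$. Solutions are classical ($C^2$). A domain is a connected open set; in the last estimate $\partial\Omega\neq\emptyset$. *)

theory Defs
  imports "HOL-Analysis.Analysis"
begin

definition partial_deriv :: "'n::finite \<Rightarrow> (real^'n \<Rightarrow> real) \<Rightarrow> real^'n \<Rightarrow> real" where
  "partial_deriv i f x = deriv (\<lambda>t. f (x + t *\<^sub>R axis i 1)) 0"

definition gradient :: "(real^'n::finite \<Rightarrow> real) \<Rightarrow> real^'n \<Rightarrow> real^'n" where
  "gradient f x = (\<chi> i. partial_deriv i f x)"

definition laplacian :: "(real^'n::finite \<Rightarrow> real) \<Rightarrow> real^'n \<Rightarrow> real" where
  "laplacian f x = (\<Sum>i\<in>UNIV. partial_deriv i (partial_deriv i f) x)"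

text \<open>
  Functions are total, but only their values on the open set \<open>S\<close> matter below.
  Since \<^const>\<open>deriv\<close> has an arbitrary value where no derivative exists, the existence of
  the derivatives is required explicitly. Continuity of the function and of its first
  partial derivatives follows from their (Frechet) differentiability.
\<close>

definition C2_on :: "(real^'n::finite) set \<Rightarrow> (real^'n \<Rightarrow> real) \<Rightarrow> bool" where
  "C2_on S f \<longleftrightarrow>
     (\<forall>x\<in>S. f differentiable at x) \<and>
     (\<forall>i. \<forall>x\<in>S. partial_deriv i f differentiable at x) \<and>
     (\<forall>i j. continuous_on S (partial_deriv j (partial_deriv i f)))"

definition positive_solution ::
    "real \<Rightarrow> real \<Rightarrow> real \<Rightarrow> (real^'n::finite) set \<Rightarrow> (real^'n \<Rightarrow> real) \<Rightarrow> bool" where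
  "positive_solution p q M S u \<longleftrightarrow>
     C2_on S u \<and>
     (\<forall>x\<in>S. 0 < u x) \<and>
     (\<forall>x\<in>S. - laplacian u x =
              \<bar>u x\<bar> powr (p - 1) * u x + M * norm (gradient u x) powr q)"

end

theory Submission imports Defs begin

text \<open>
  All three assertions follow from one local estimate: if \<open>u\<close> is a positive solution on a ball of
  radius \<open>R\<close> and \<open>|M|\<close> is small, then \<open>R w \<le> K\<^sub>0\<close> at the centre, where
  \<open>w = u\<^bsup>(p-1)/2\<^esup> + |\<nabla>u|\<^bsup>(p-1)/(p+1)\<^esup>\<close> is the weight that the scaling of the equation turns into an
  inverse length. Doubling and rescaling reduce this to solutions on a ball of radius \<open>k\<close> with
  \<open>w \<le> 2\<close> and \<open>w(0) = 1\<close>, for which \<open>k\<close> has to be bounded.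

  The Gidas-Spruck method gives \<open>\<integral> u\<^bsup>\<gamma>+2p\<^esup> \<le> C k\<^bsup>N-\<sigma>\<^esup>\<close> over the ball of radius \<open>k/2\<close>, with \<open>\<sigma> > N\<close>
  because \<open>p\<close> is subcritical. The gradient term is absorbed in the integrals, since
  \<open>|\<nabla>u|\<^bsup>q\<^esup> \<le> |\<nabla>u|\<^sup>2/u + u\<^bsup>p\<^esup>\<close> pointwise for \<open>q = 2p/(p+1)\<close>. Conversely, \<open>w(0) = 1\<close> forces \<open>u\<close> to be bounded
  below on a ball of fixed size: either \<open>u(0)\<close> is not small, or \<open>|\<nabla>u(0)|\<close> is not small and then the
  maximum principle yields a nearby point where \<open>u\<close> is not small. Hence \<open>k\<close> cannot be large. No elliptic
  regularity or compactness is needed.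
\<close>

text \<open>For a C2 solution there is no pointwise Bochner formula. Its integrated form against a
  weight \<open>\<phi> * u powr \<gamma>\<close> survives and is combined with three divergence
  identities that carry free parameters \<open>t\<close>, \<open>\<mu>\<close>,
  \<open>\<gamma>\<close>. The Hessian is then eliminated by Cauchy-Schwarz for the trace of D^2 u +
  (b/u) grad u (x) grad u, where b is forced by the requirement that u_i u_j u_ij disappear. What
  remains is a quadratic form in A = |grad u|^2 / u and B = u^p. Parameters that make it strictly
  negative for A, B \<ge> 0 exist because p < (N+2)/(N-2) leaves an open interval for
  \<open>t\<close>. Strict negativity tolerates an error in the equation of a small multiple of A +
  B; this tolerance is the source of epsilon_0. The rate k^(N-\<sigma>) does the work of a
  compactness argument: a Liouville theorem alone would exclude only k = infinity, while the rate
  bounds k by a constant depending on N and p.\<close>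

section \<open>Partial derivatives and integration by parts\<close>

text \<open>A relation, unlike the function \<open>partial_deriv\<close>, records that the
  derivative exists. Restriction to a line lets the calculus rules below be read off from the
  one-variable \<open>DERIV\<close> rules.\<close>

definition has_pderiv :: "'n::finite \<Rightarrow> (real^'n \<Rightarrow> real) \<Rightarrow> real \<Rightarrow> real^'n \<Rightarrow> bool" where
  "has_pderiv i f d x \<longleftrightarrow> ((\<lambda>t. f (x + t *\<^sub>R axis i 1)) has_real_derivative d) (at 0)"

lemma has_pderiv_cong:
  assumes "has_pderiv i f d x" "open S" "x \<in> S" "\<And>y. y \<in> S \<Longrightarrow> f y = g y"
  shows "has_pderiv i g d x"
proof -
  have "((\<lambda>t::real. x + t *\<^sub>R axis i 1) \<longlongrightarrow> x + 0 *\<^sub>R axis i 1) (nhds 0)"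
    by (intro tendsto_intros filterlim_ident)
  then have "\<forall>\<^sub>F t in nhds 0. x + t *\<^sub>R axis i (1::real) \<in> S"
    using assms(2,3) by (auto dest: topological_tendstoD)
  then have "\<forall>\<^sub>F t in nhds 0. f (x + t *\<^sub>R axis i 1) = g (x + t *\<^sub>R axis i 1)"
    by eventually_elim (use assms(4) in auto)
  then show ?thesis
    using assms(1) unfolding has_pderiv_def
    by (subst (asm) DERIV_cong_ev[OF refl _ refl])
qed

lemma has_pderiv_along_line:
  assumes "has_pderiv i f d (x + t *\<^sub>R axis i 1)"
  shows "((\<lambda>s. f (x + s *\<^sub>R axis i 1)) has_real_derivative d) (at t)"
proof -
  have "((\<lambda>s. f (x + (s + t) *\<^sub>R axis i 1)) has_real_derivative d) (at 0)"
    using assms unfolding has_pderiv_def by (simp add: algebra_simps)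
  then show ?thesis
    using DERIV_shift[of "\<lambda>s. f (x + s *\<^sub>R axis i 1)" d 0 t] by simp
qed

lemma has_pderiv_of_derivative:
  assumes "(f has_derivative f') (at x)"
  shows "has_pderiv i f (f' (axis i 1)) x"
proof -
  interpret bounded_linear f' using assms by (rule has_derivative_bounded_linear)
  have "((\<lambda>t::real. x + t *\<^sub>R axis i 1) has_derivative (\<lambda>t. t *\<^sub>R axis i 1)) (at 0)"
    by (auto intro!: derivative_eq_intros)
  then have "((\<lambda>t. f (x + t *\<^sub>R axis i 1)) has_derivative (\<lambda>t. f' (t *\<^sub>R axis i 1))) (at 0)"
    using assms has_derivative_compose[of "\<lambda>t::real. x + t *\<^sub>R axis i 1" _ 0 UNIV f f'] by simp
  then show ?thesis
    unfolding has_pderiv_def has_field_derivative_def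
    by (simp add: scaleR mult.commute[of _ "f' (axis i 1)"])
qed

lemma has_pderiv_add:
  "has_pderiv i f a x \<Longrightarrow> has_pderiv i g b x \<Longrightarrow> has_pderiv i (\<lambda>x. f x + g x) (a + b) x"
  unfolding has_pderiv_def by (rule DERIV_add)

lemma has_pderiv_diff:
  "has_pderiv i f a x \<Longrightarrow> has_pderiv i g b x \<Longrightarrow> has_pderiv i (\<lambda>x. f x - g x) (a - b) x"
  unfolding has_pderiv_def by (rule DERIV_diff)

lemma has_pderiv_cmult:
  "has_pderiv i f a x \<Longrightarrow> has_pderiv i (\<lambda>x. c * f x) (c * a) x"
  unfolding has_pderiv_def by (rule DERIV_cmult)

lemma has_pderiv_mult:
  "has_pderiv i f a x \<Longrightarrow> has_pderiv i g b x \<Longrightarrow>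
   has_pderiv i (\<lambda>x. f x * g x) (a * g x + b * f x) x"
  unfolding has_pderiv_def
  using DERIV_mult[of "\<lambda>t. f (x + t *\<^sub>R axis i 1)" a 0 UNIV "\<lambda>t. g (x + t *\<^sub>R axis i 1)" b] by simp

lemma has_pderiv_powr:
  assumes "has_pderiv i f a x" "0 < f x"
  shows "has_pderiv i (\<lambda>x. f x powr r) (r * f x powr (r - 1) * a) x"
  using DERIV_fun_powr[of "\<lambda>t. f (x + t *\<^sub>R axis i 1)" a 0 r] assms
  unfolding has_pderiv_def by simp

lemma has_pderiv_sum:
  "(\<And>j. j \<in> A \<Longrightarrow> has_pderiv i (f j) (a j) x) \<Longrightarrow> has_pderiv i (\<lambda>x. \<Sum>j\<in>A. f j x) (\<Sum>j\<in>A. a j) x"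
  unfolding has_pderiv_def by (rule DERIV_sum) auto

lemma has_pderiv_component: "has_pderiv i (\<lambda>x. x $ j) (if i = j then 1 else 0) x"
  unfolding has_pderiv_def by (auto intro!: derivative_eq_intros simp: axis_def)

lemma has_pderiv_shift: "has_pderiv i f d (x + c) \<Longrightarrow> has_pderiv i (\<lambda>x. f (x + c)) d x"
  unfolding has_pderiv_def by (simp add: algebra_simps)

lemma has_pderiv_cong_value: "has_pderiv i f a x \<Longrightarrow> a = b \<Longrightarrow> has_pderiv i f b x"
  by simp

lemma has_pderiv_imp_partial_deriv: "has_pderiv i f d x \<Longrightarrow> partial_deriv i f x = d"
  unfolding has_pderiv_def partial_deriv_def by (rule DERIV_imp_deriv)

lemma pderiv_mean_value:
  assumes "0 < h" "\<And>s. 0 \<le> s \<Longrightarrow> s \<le> h \<Longrightarrow> has_pderiv i f (f' (x + s *\<^sub>R axis i 1)) (x + s *\<^sub>R axis i 1)"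
  obtains s where "0 < s" "s < h" "f (x + h *\<^sub>R axis i 1) - f x = h * f' (x + s *\<^sub>R axis i 1)"
proof -
  have "\<exists>s>0. s < h \<and> f (x + h *\<^sub>R axis i 1) - f (x + 0 *\<^sub>R axis i 1)
        = (h - 0) * f' (x + s *\<^sub>R axis i 1)"
    by (rule MVT2) (use assms in \<open>auto intro: has_pderiv_along_line\<close>)
  then show ?thesis using that by auto
qed

text \<open>Schwarz's theorem. The second difference of \<open>u\<close> over a square of side
  \<open>h\<close> is symmetric in \<open>i\<close> and \<open>j\<close>, and two applications of
  the mean value theorem, in either order, write it as \<open>h * h\<close> times a value of
  \<open>c\<close> or of \<open>d\<close> near \<open>x\<close>. Continuity identifies the two
  limits.\<close>

lemma symmetric_second_pderiv:
  fixes x :: "real^'n::finite"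
  assumes "0 < r"
    and i: "\<And>y. y \<in> ball x r \<Longrightarrow> has_pderiv i u (a y) y"
    and j: "\<And>y. y \<in> ball x r \<Longrightarrow> has_pderiv j u (b y) y"
    and ij: "\<And>y. y \<in> ball x r \<Longrightarrow> has_pderiv j a (c y) y"
    and ji: "\<And>y. y \<in> ball x r \<Longrightarrow> has_pderiv i b (d y) y"
    and cont: "continuous_on (ball x r) c" "continuous_on (ball x r) d"
  shows "c x = d x"
proof -
  let ?e = "\<lambda>i. axis i (1::real) :: real^'n"
  have step: "\<exists>s\<in>{0..h}. \<exists>t\<in>{0..h}.
      u (x + h *\<^sub>R ?e i + h *\<^sub>R ?e j) - u (x + h *\<^sub>R ?e i) - (u (x + h *\<^sub>R ?e j) - u x)
      = h * h * c (x + s *\<^sub>R ?e i + t *\<^sub>R ?e j)"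
    if h: "0 < h" "2 * h < r"
      and i: "\<And>y. y \<in> ball x r \<Longrightarrow> has_pderiv i u (a y) y"
      and ij: "\<And>y. y \<in> ball x r \<Longrightarrow> has_pderiv j a (c y) y" for h i j a c
  proof -
    have inb: "x + s *\<^sub>R ?e i + t *\<^sub>R ?e j \<in> ball x r" if "0 \<le> s" "s \<le> h" "0 \<le> t" "t \<le> h" for s t
    proof -
      have "norm (s *\<^sub>R ?e i + t *\<^sub>R ?e j) \<le> norm (s *\<^sub>R ?e i) + norm (t *\<^sub>R ?e j)"
        by (rule norm_triangle_ineq)
      also have "\<dots> < r" using that h by (simp add: norm_axis_1)
      finally show ?thesis by (simp add: dist_norm norm_minus_commute add.commute)
    qed
    obtain s where s: "0 < s" "s < h"
      and "(u (x + h *\<^sub>R ?e i + h *\<^sub>R ?e j) - u (x + h *\<^sub>R ?e i)) - (u (x + h *\<^sub>R ?e j) - u x)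
        = h * (a (x + s *\<^sub>R ?e i + h *\<^sub>R ?e j) - a (x + s *\<^sub>R ?e i))"
    proof (rule pderiv_mean_value[where f = "\<lambda>y. u (y + h *\<^sub>R ?e j) - u y" and x = x and h = h and i = i
          and f' = "\<lambda>y. a (y + h *\<^sub>R ?e j) - a y"])
      fix s assume "0 \<le> s" "s \<le> h"
      then have "has_pderiv i u (a (x + s *\<^sub>R ?e i + h *\<^sub>R ?e j)) (x + s *\<^sub>R ?e i + h *\<^sub>R ?e j)"
        "has_pderiv i u (a (x + s *\<^sub>R ?e i)) (x + s *\<^sub>R ?e i)"
        using i inb[of s h] inb[of s 0] h by auto
      then show "has_pderiv i (\<lambda>y. u (y + h *\<^sub>R ?e j) - u y)
          (a (x + s *\<^sub>R ?e i + h *\<^sub>R ?e j) - a (x + s *\<^sub>R ?e i)) (x + s *\<^sub>R ?e i)"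
        unfolding has_pderiv_def by (auto intro!: DERIV_diff simp: algebra_simps)
    qed (use h in auto)
    moreover obtain t where "0 < t" "t < h"
      "a (x + s *\<^sub>R ?e i + h *\<^sub>R ?e j) - a (x + s *\<^sub>R ?e i) = h * c (x + s *\<^sub>R ?e i + t *\<^sub>R ?e j)"
      by (rule pderiv_mean_value[of h j a c "x + s *\<^sub>R ?e i"])
        (use h s ij inb in auto)
    ultimately show ?thesis
      by (intro bexI[of _ s] bexI[of _ t]) auto
  qed
  define h where "h n = r / (4 * (real n + 1))" for n
  have h: "0 < h n" "2 * h n < r" for n
  proof -
    show "0 < h n" using \<open>0 < r\<close> by (simp add: h_def)
    have "r * 1 \<le> r * (real n + 1)" using \<open>0 < r\<close> by (intro mult_left_mono) auto
    then have "r * 1 < 2 * (r * (real n + 1))" using \<open>0 < r\<close> by linarith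
    then show "2 * h n < r" by (simp add: h_def divide_less_eq) (simp add: algebra_simps)
  qed
  have "(\<lambda>n. r / 4 * (1 / real (Suc n))) \<longlonglongrightarrow> r / 4 * 0"
    by (intro tendsto_mult tendsto_const) (use LIMSEQ_inverse_real_of_nat in \<open>simp add: inverse_eq_divide\<close>)
  then have h0: "h \<longlonglongrightarrow> 0"
    by (simp add: h_def[abs_def] add.commute field_simps)
  let ?q = "\<lambda>n. (u (x + h n *\<^sub>R ?e i + h n *\<^sub>R ?e j) - u (x + h n *\<^sub>R ?e i) - (u (x + h n *\<^sub>R ?e j) - u x)) / (h n * h n)"
  have lim: "?q \<longlonglongrightarrow> c x"
    if c: "continuous_on (ball x r) c" and st: "\<And>n. \<exists>s\<in>{0..h n}. \<exists>t\<in>{0..h n}. ?q n = c (x + s *\<^sub>R ?e i + t *\<^sub>R ?e j)"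
    for c
  proof -
    obtain s t where st: "\<And>n. s n \<in> {0..h n}" "\<And>n. t n \<in> {0..h n}"
      "\<And>n. ?q n = c (x + s n *\<^sub>R ?e i + t n *\<^sub>R ?e j)"
      using st by metis
    have "s \<longlonglongrightarrow> 0" "t \<longlonglongrightarrow> 0"
      using st by (auto intro!: tendsto_sandwich[OF _ _ tendsto_const h0])
    then have "(\<lambda>n. x + s n *\<^sub>R ?e i + t n *\<^sub>R ?e j) \<longlonglongrightarrow> x + 0 *\<^sub>R ?e i + 0 *\<^sub>R ?e j"
      by (intro tendsto_intros)
    then have "(\<lambda>n. x + s n *\<^sub>R ?e i + t n *\<^sub>R ?e j) \<longlonglongrightarrow> x" by simp
    moreover have "isCont c x"
      using c \<open>0 < r\<close> by (simp add: continuous_on_eq_continuous_at)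
    ultimately show ?thesis
      unfolding st(3) by (rule isCont_tendsto_compose[rotated])
  qed
  have "?q \<longlonglongrightarrow> c x"
  proof (rule lim[OF cont(1)])
    fix n
    show "\<exists>s\<in>{0..h n}. \<exists>t\<in>{0..h n}. ?q n = c (x + s *\<^sub>R ?e i + t *\<^sub>R ?e j)"
      using step[OF h[of n], of i a j c] i ij h(1)[of n] by (auto simp: field_simps)
  qed
  moreover have "?q \<longlonglongrightarrow> d x"
  proof (rule lim[OF cont(2)])
    fix n
    have "\<exists>s\<in>{0..h n}. \<exists>t\<in>{0..h n}. u (x + h n *\<^sub>R ?e j + h n *\<^sub>R ?e i) - u (x + h n *\<^sub>R ?e j) - (u (x + h n *\<^sub>R ?e i) - u x)
      = h n * h n * d (x + s *\<^sub>R ?e j + t *\<^sub>R ?e i)"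
      using step[OF h[of n], of j b i d] j ji by auto
    then obtain s t where st: "s \<in> {0..h n}" "t \<in> {0..h n}"
      and "u (x + h n *\<^sub>R ?e j + h n *\<^sub>R ?e i) - u (x + h n *\<^sub>R ?e j) - (u (x + h n *\<^sub>R ?e i) - u x)
      = h n * h n * d (x + s *\<^sub>R ?e j + t *\<^sub>R ?e i)" by auto
    then have "?q n = d (x + t *\<^sub>R ?e i + s *\<^sub>R ?e j)"
      using h(1)[of n] by (simp add: field_simps)
    then show "\<exists>s\<in>{0..h n}. \<exists>t\<in>{0..h n}. ?q n = d (x + s *\<^sub>R ?e i + t *\<^sub>R ?e j)"
      using st by blast
  qed
  ultimately show ?thesis by (rule LIMSEQ_unique)
qed

section \<open>Integrals of compactly supported functions and of their derivatives\<close>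

lemma continuous_on_UNIV_if_compact_support:
  fixes f :: "real^'n::finite \<Rightarrow> real"
  assumes "k < K" "continuous_on (ball 0 K) f" "\<And>x. k \<le> norm x \<Longrightarrow> f x = 0"
  shows "continuous_on UNIV f"
proof -
  have "continuous_on (- cball 0 k) f"
    by (rule continuous_on_eq[of _ "\<lambda>_. 0"]) (use assms(3) in auto)
  then have "continuous_on (ball 0 K \<union> - cball 0 k) f"
    using assms(2) by (intro continuous_on_open_Un) (auto simp: open_Compl)
  moreover have "ball 0 K \<union> - cball 0 k = (UNIV :: (real^'n) set)"
    using assms(1) by auto
  ultimately show ?thesis by simp
qed

lemma integrable_compact_support:
  fixes f :: "real^'n::finite \<Rightarrow> real"
  assumes "continuous_on UNIV f" "\<And>x. k \<le> norm x \<Longrightarrow> f x = 0"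
  shows "integrable lborel f"
proof -
  have "integrable lborel (\<lambda>x. indicator (cball 0 k) x *\<^sub>R f x)"
    by (intro borel_integrable_compact continuous_on_subset[OF assms(1)]) auto
  moreover have "(\<lambda>x. indicator (cball 0 k) x *\<^sub>R f x) = f"
    using assms(2) by (auto simp: indicator_def fun_eq_iff)
  ultimately show ?thesis by simp
qed

lemma bounded_compact_support:
  fixes f :: "real^'n::finite \<Rightarrow> real"
  assumes "continuous_on UNIV f" "\<And>x. k \<le> norm x \<Longrightarrow> f x = 0"
  obtains B where "0 < B" "\<And>x. \<bar>f x\<bar> \<le> B"
proof -
  have "compact (f ` cball 0 k)"
    by (intro compact_continuous_image continuous_on_subset[OF assms(1)]) auto
  then obtain B where B: "0 < B" "\<forall>y\<in>f ` cball 0 k. norm y \<le> B"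
    using compact_imp_bounded bounded_pos by blast
  have "\<bar>f x\<bar> \<le> B" for x
    using B assms(2)[of x] by (cases "norm x \<le> k") auto
  then show ?thesis using that B(1) by blast
qed

lemma integral_translate:
  fixes F :: "real^'n::finite \<Rightarrow> real"
  assumes "F \<in> borel_measurable borel"
  shows "integral\<^sup>L lborel (\<lambda>x. F (x + c)) = integral\<^sup>L lborel F"
proof -
  have "integral\<^sup>L (distr lborel borel ((+) c)) F = integral\<^sup>L lborel (\<lambda>x. F (c + x))"
    using assms by (intro integral_distr) auto
  then show ?thesis by (simp add: lborel_distr_plus add.commute)
qed

text \<open>Translation invariance makes every difference quotient \<open>s n\<close> of
  \<open>F\<close> integrate to 0, and dominated convergence passes to the derivative. This takes
  the place of Fubini along coordinate lines.\<close>

lemma integral_pderiv_UNIV: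
  fixes F F' :: "real^'n::finite \<Rightarrow> real"
  assumes "0 < k" "continuous_on UNIV F" "continuous_on UNIV F'"
    and F0: "\<And>x. k \<le> norm x \<Longrightarrow> F x = 0" and F'0: "\<And>x. k \<le> norm x \<Longrightarrow> F' x = 0"
    and deriv: "\<And>x. has_pderiv i F (F' x) x"
  shows "has_bochner_integral lborel F' 0"
proof -
  let ?e = "axis i (1::real) :: real^'n"
  define h where "h n = 1 / (real n + 1)" for n
  have h: "0 < h n" "h n \<le> 1" for n by (auto simp: h_def)
  have h0: "h \<longlonglongrightarrow> 0"
    using LIMSEQ_inverse_real_of_nat by (simp add: h_def[abs_def] inverse_eq_divide add.commute)
  define s where "s n x = (F (x + h n *\<^sub>R ?e) - F x) / h n" for n x
  have int: "integrable lborel F" "integrable lborel F'"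
    using assms integrable_compact_support by blast+
  have meas [measurable]: "F \<in> borel_measurable borel" "F' \<in> borel_measurable borel"
    using assms(2,3) by (auto intro: borel_measurable_continuous_onI)
  obtain B where B: "0 < B" "\<And>x. \<bar>F' x\<bar> \<le> B"
    using bounded_compact_support[OF assms(3) F'0] by blast
  have intsh: "integrable lborel (\<lambda>x. F (x + c))" for c
  proof (rule integrable_compact_support)
    show "continuous_on UNIV (\<lambda>x. F (x + c))"
      by (intro continuous_on_compose2[OF assms(2)] continuous_intros) auto
    show "F (x + c) = 0" if "k + norm c \<le> norm x" for x
      using that norm_triangle_ineq4[of "x + c" c] by (intro F0) simp
  qed
  have ints: "integral\<^sup>L lborel (s n) = 0" for n
  proof -
    have "integral\<^sup>L lborel (s n)
        = (integral\<^sup>L lborel (\<lambda>x. F (x + h n *\<^sub>R ?e)) - integral\<^sup>L lborel F) / h n"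
      unfolding s_def using int intsh by (simp add: Bochner_Integration.integral_diff)
    then show ?thesis by (simp add: integral_translate)
  qed
  have "(\<lambda>n. integral\<^sup>L lborel (s n)) \<longlonglongrightarrow> integral\<^sup>L lborel F'"
  \<comment> \<open>The mean value theorem bounds the quotients by \<open>B\<close>; since
    \<open>h n \<le> 1\<close>, they vanish beyond radius \<open>k + 1\<close>.\<close>
  proof (rule integral_dominated_convergence[where w = "\<lambda>x. B * indicator (cball 0 (k + 1)) x"])
    show "s n \<in> borel_measurable lborel" for n unfolding s_def by measurable
    show "integrable lborel (\<lambda>x::real^'n. B * indicator (cball 0 (k + 1)) x)"
      using borel_integrable_compact[of "cball (0::real^'n) (k+1)" "\<lambda>_. B"]
      by (simp add: mult.commute)
    show "AE x in lborel. (\<lambda>n. s n x) \<longlonglongrightarrow> F' x"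
    proof (rule AE_I2)
      fix x
      have "((\<lambda>t. (F (x + t *\<^sub>R ?e) - F x) / t) \<longlongrightarrow> F' x) (at 0)"
        using deriv[of x] unfolding has_pderiv_def DERIV_def by simp
      moreover have "filterlim h (at 0) sequentially"
        using h0 h(1) by (auto simp: filterlim_at less_imp_neq[symmetric] intro!: always_eventually)
      ultimately show "(\<lambda>n. s n x) \<longlonglongrightarrow> F' x"
        unfolding s_def by (rule filterlim_compose)
    qed
    show "AE x in lborel. norm (s n x) \<le> B * indicator (cball 0 (k + 1)) x" for n
    proof (rule AE_I2)
      fix x
      obtain t where "F (x + h n *\<^sub>R ?e) - F x = h n * F' (x + t *\<^sub>R ?e)"
        by (rule pderiv_mean_value[of "h n" i F F' x]) (use h deriv in auto)
      then have "s n x = F' (x + t *\<^sub>R ?e)" using h(1)[of n] by (simp add: s_def)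
      then have "\<bar>s n x\<bar> \<le> B" using B(2) by simp
      moreover have "s n x = 0" if "k + 1 < norm x"
      proof -
        have "norm x \<le> norm (x + h n *\<^sub>R ?e) + norm (h n *\<^sub>R ?e)"
          using norm_triangle_ineq4[of "x + h n *\<^sub>R ?e" "h n *\<^sub>R ?e"] by simp
        then have "norm x \<le> norm (x + h n *\<^sub>R ?e) + h n" using h(1)[of n] by (simp add: norm_axis_1)
        then have "k \<le> norm (x + h n *\<^sub>R ?e)" using that h(2)[of n] by linarith
        then show ?thesis using F0 that by (simp add: s_def)
      qed
      ultimately show "norm (s n x) \<le> B * indicator (cball 0 (k + 1)) x"
        by (cases "k + 1 < norm x") (auto simp: indicator_def)
    qed
  qed simp_all
  then have "integral\<^sup>L lborel F' = 0" using ints by (simp add: LIMSEQ_const_iff)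
  then show ?thesis using int(2) by (simp add: has_bochner_integral_iff)
qed

text \<open>Extension by zero. A solution is controlled only inside \<open>ball 0 K\<close>, while
  the cutoff makes the integrands vanish from the smaller radius \<open>k\<close> on, so that the
  edge of the ball is never seen.\<close>

lemma integral_pderiv:
  fixes F F' :: "real^'n::finite \<Rightarrow> real"
  assumes "0 < k" "k < K" "continuous_on (ball 0 K) F" "continuous_on (ball 0 K) F'"
    and F0: "\<And>x. k \<le> norm x \<Longrightarrow> F x = 0" and F'0: "\<And>x. k \<le> norm x \<Longrightarrow> F' x = 0"
    and deriv: "\<And>x. x \<in> ball 0 K \<Longrightarrow> has_pderiv i F (F' x) x"
  shows "has_bochner_integral lborel F' 0"
proof (rule integral_pderiv_UNIV[OF \<open>0 < k\<close> _ _ F0 F'0])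
  show "has_pderiv i F (F' x) x" for x
  proof (cases "x \<in> ball 0 K")
    case False
    then have x: "k < norm x" using \<open>k < K\<close> by auto
    show ?thesis
    proof (rule has_pderiv_cong[where f = "\<lambda>_. 0" and S = "- cball 0 k"])
      show "has_pderiv i (\<lambda>_. 0) (F' x) x"
        using F'0[of x] x by (simp add: has_pderiv_def)
    qed (use x F0 in auto)
  qed (rule deriv)
qed (use assms continuous_on_UNIV_if_compact_support in blast)+

section \<open>Integral identities\<close>

text \<open>Gradient and Hessian are parameters instead of iterated \<open>partial_deriv\<close>: a
  translated and rescaled solution then instantiates the locale with explicitly scaled
  \<open>G\<close> and \<open>H\<close>.\<close>

locale C2_ball =
  fixes K :: real and u :: "real^'n::finite \<Rightarrow> real"
    and G :: "real^'n \<Rightarrow> real^'n" and H :: "real^'n \<Rightarrow> real^'n^'n"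
  assumes u_deriv: "x \<in> ball 0 K \<Longrightarrow> (u has_derivative (\<lambda>h. G x \<bullet> h)) (at x)"
    and G_deriv: "x \<in> ball 0 K \<Longrightarrow> (G has_derivative (\<lambda>h. H x *v h)) (at x)"
    and H_sym: "x \<in> ball 0 K \<Longrightarrow> H x $ i $ j = H x $ j $ i"
    and H_cont: "continuous_on (ball 0 K) H"
begin

lemma u_pderiv: "x \<in> ball 0 K \<Longrightarrow> has_pderiv i u (G x $ i) x"
  using has_pderiv_of_derivative[OF u_deriv] by (simp add: inner_axis)

lemma G_pderiv:
  assumes "x \<in> ball 0 K"
  shows "has_pderiv j (\<lambda>x. G x $ i) (H x $ i $ j) x"
proof -
  have "((\<lambda>x. G x $ i) has_derivative (\<lambda>h. (H x *v h) $ i)) (at x)"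
    using bounded_linear.has_derivative[OF bounded_linear_vec_nth G_deriv[OF assms]] .
  from has_pderiv_of_derivative[OF this, of j] show ?thesis
    by (simp add: matrix_vector_mult_basis column_def)
qed

lemma u_cont: "continuous_on (ball 0 K) u"
  by (rule continuous_at_imp_continuous_on) (blast intro: has_derivative_continuous u_deriv)

lemma G_cont: "continuous_on (ball 0 K) G"
  by (rule continuous_at_imp_continuous_on) (blast intro: has_derivative_continuous G_deriv)

lemma G_component_cont: "continuous_on (ball 0 K) (\<lambda>x. G x $ i)"
  by (intro continuous_intros G_cont)

lemma H_component_cont: "continuous_on (ball 0 K) (\<lambda>x. H x $ i $ j)"
  by (intro continuous_intros H_cont)

text \<open>Formally, this is two integrations by parts applied to \<open>\<Phi> (u\<^sub>i\<^sub>i u\<^sub>j\<^sub>j - u\<^sub>i\<^sub>j\<^sup>2)\<close>. The third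
  derivatives of \<open>u\<close> need not exist, so one factor \<open>\<partial>\<^sub>l\<partial>\<^sub>j u\<close> is first replaced by a
  difference quotient of \<open>\<partial>\<^sub>l u\<close> in direction \<open>j\<close>.\<close>

lemma integral_hessian_minor:
  assumes k: "0 < k" "k < K"
    and \<Phi>: "continuous_on (ball 0 K) \<Phi>" "\<And>i. continuous_on (ball 0 K) (\<Phi>' i)"
      "\<And>x. k \<le> norm x \<Longrightarrow> \<Phi> x = 0" "\<And>i x. k \<le> norm x \<Longrightarrow> \<Phi>' i x = 0"
      "\<And>i x. x \<in> ball 0 K \<Longrightarrow> has_pderiv i \<Phi> (\<Phi>' i x) x"
  shows "has_bochner_integral lborel
    (\<lambda>x. \<Phi> x * (H x $ i $ i * H x $ j $ j - H x $ i $ j * H x $ i $ j)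
       - G x $ i * (\<Phi>' j x * H x $ i $ j - \<Phi>' i x * H x $ j $ j)) 0"
proof -
  let ?e = "axis j (1::real) :: real^'n"
  \<comment> \<open>An intermediate radius: translating a point of \<open>ball 0 K'\<close> by
    \<open>h n\<close> in direction \<open>j\<close> stays in \<open>ball 0 K\<close>, so the
    quotients are differentiable on a ball that still contains the support of
    \<open>\<Phi>\<close>.\<close>
  define K' where "K' = (k + K) / 2"
  have K': "k < K'" "K' < K" "0 < K'" using k by (auto simp: K'_def)
  define h where "h n = (K - K') / (real n + 1)" for n
  have h: "0 < h n" "h n \<le> K - K'" for n
  proof -
    show "0 < h n" using K' by (simp add: h_def)
    have "(K - K') * 1 \<le> (K - K') * (real n + 1)" using K' by (intro mult_left_mono) auto
    then show "h n \<le> K - K'" by (simp add: h_def divide_le_eq)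
  qed
  have "(\<lambda>n. (K - K') * (1 / real (Suc n))) \<longlonglongrightarrow> (K - K') * 0"
    by (intro tendsto_mult tendsto_const) (use LIMSEQ_inverse_real_of_nat in \<open>simp add: inverse_eq_divide\<close>)
  then have h0: "h \<longlonglongrightarrow> 0"
    by (simp add: h_def[abs_def] add.commute)
  have shift: "x + s *\<^sub>R ?e \<in> ball 0 K" if "norm x \<le> K'" "0 \<le> s" "s \<le> h n" "norm x < K' \<or> s < h n" for x s n
    using that h(2)[of n] norm_triangle_ineq[of x "s *\<^sub>R ?e"] by auto
  have sub: "ball 0 K' \<subseteq> (ball 0 K :: (real^'n) set)" using K' by auto
  define q where "q n l x = (G (x + h n *\<^sub>R ?e) $ l - G x $ l) / h n" for n l x
  define dq where "dq n l i x = (H (x + h n *\<^sub>R ?e) $ l $ i - H x $ l $ i) / h n" for n l i x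
  have q_deriv: "has_pderiv i (q n l) (dq n l i x) x" if "x \<in> ball 0 K'" for n l i x
  proof -
    have "has_pderiv i (\<lambda>x. (1 / h n) * (G (x + h n *\<^sub>R ?e) $ l - G x $ l))
        ((1 / h n) * (H (x + h n *\<^sub>R ?e) $ l $ i - H x $ l $ i)) x"
      using that h[of n] sub shift[of x "h n" n]
      by (intro has_pderiv_cmult has_pderiv_diff has_pderiv_shift[of i "\<lambda>x. G x $ l"] G_pderiv) auto
    then show ?thesis by (simp add: q_def[abs_def] dq_def)
  qed
  have conts: "continuous_on (ball 0 K') (\<lambda>x. f (x + h n *\<^sub>R ?e))" if "continuous_on (ball 0 K) f"
    for f :: "real^'n \<Rightarrow> real" and n
  proof (rule continuous_on_compose2[OF that])
    show "(\<lambda>x. x + h n *\<^sub>R ?e) ` ball 0 K' \<subseteq> ball 0 K"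
      using shift[of _ "h n" n] h(1)[of n] by (intro image_subsetI) simp
  qed (intro continuous_intros)
  have q_cont: "continuous_on (ball 0 K') (q n l)" for n l
    unfolding q_def using h(1)[of n]
    by (intro continuous_intros conts G_component_cont continuous_on_subset[OF G_component_cont sub]) auto
  have dq_cont: "continuous_on (ball 0 K') (dq n l i)" for n l i
    unfolding dq_def using h(1)[of n]
    by (intro continuous_intros conts H_component_cont continuous_on_subset[OF H_component_cont sub]) auto
  note cont' = \<Phi>(1) \<Phi>(2) G_component_cont H_component_cont
  note cont = cont'[THEN continuous_on_subset[OF _ sub]] q_cont dq_cont
  \<comment> \<open>The integrand is the \<open>a\<close>-th derivative of the product of
    \<open>\<Phi>\<close>, u_i and the quotient for \<open>b\<close>. The pairs (a, b) = (i, j) and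
    (j, i) are subtracted below: their \<open>dq\<close> terms, which stand for third derivatives,
    cancel by symmetry of \<open>H\<close>.\<close>
  have one: "has_bochner_integral lborel (\<lambda>x. \<Phi>' a x * G x $ i * q n b x
      + \<Phi> x * H x $ i $ a * q n b x + \<Phi> x * G x $ i * dq n b a x) 0" for a b n
  proof (rule integral_pderiv[OF \<open>0 < k\<close> K'(1), where F = "\<lambda>x. \<Phi> x * G x $ i * q n b x"])
    fix x :: "real^'n" assume x: "x \<in> ball 0 K'"
    show "has_pderiv a (\<lambda>x. \<Phi> x * G x $ i * q n b x)
       (\<Phi>' a x * G x $ i * q n b x + \<Phi> x * H x $ i $ a * q n b x + \<Phi> x * G x $ i * dq n b a x) x"
      using has_pderiv_mult[OF has_pderiv_mult[OF \<Phi>(5)[of x a] G_pderiv[of x a i]] q_deriv[of x a n b]]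
        x sub by (auto simp: algebra_simps)
  qed (use \<Phi> in \<open>auto intro!: continuous_intros cont\<close>)
  define Q where "Q n x = \<Phi> x * (H x $ i $ i * q n j x - H x $ i $ j * q n i x)
       - G x $ i * (\<Phi>' j x * q n i x - \<Phi>' i x * q n j x)" for n x
  have Q: "has_bochner_integral lborel (Q n) 0" for n
  proof -
    have "has_bochner_integral lborel (\<lambda>x. (\<Phi>' i x * G x $ i * q n j x
      + \<Phi> x * H x $ i $ i * q n j x + \<Phi> x * G x $ i * dq n j i x) -
      (\<Phi>' j x * G x $ i * q n i x
      + \<Phi> x * H x $ i $ j * q n i x + \<Phi> x * G x $ i * dq n i j x)) (0 - 0)"
      by (intro has_bochner_integral_diff one)
    moreover have "(\<Phi>' i x * G x $ i * q n j x
      + \<Phi> x * H x $ i $ i * q n j x + \<Phi> x * G x $ i * dq n j i x) -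
      (\<Phi>' j x * G x $ i * q n i x
      + \<Phi> x * H x $ i $ j * q n i x + \<Phi> x * G x $ i * dq n i j x) = Q n x" for x
    proof (cases "norm x < k")
      case True
      then have "dq n j i x = dq n i j x"
        using H_sym[of x i j] H_sym[of "x + h n *\<^sub>R ?e" i j] shift[of x "h n" n] h[of n] K'
        by (simp add: dq_def)
      then show ?thesis by (simp add: Q_def algebra_simps)
    qed (simp add: \<Phi> Q_def)
    ultimately show ?thesis by simp
  qed
  define R where "R x = \<bar>\<Phi> x * H x $ i $ i\<bar> + \<bar>\<Phi> x * H x $ i $ j\<bar> + \<bar>G x $ i * \<Phi>' j x\<bar> + \<bar>G x $ i * \<Phi>' i x\<bar>" for x
  define P where "P x = \<Phi> x * (H x $ i $ i * H x $ j $ j - H x $ i $ j * H x $ i $ j)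
       - G x $ i * (\<Phi>' j x * H x $ i $ j - \<Phi>' i x * H x $ j $ j)" for x
  have P_cont: "continuous_on UNIV P"
    by (rule continuous_on_UNIV_if_compact_support[OF k(2)])
      (auto simp: P_def \<Phi> intro!: continuous_intros cont')
  have R_cont: "continuous_on UNIV R"
    by (rule continuous_on_UNIV_if_compact_support[OF k(2)])
      (auto simp: R_def \<Phi> intro!: continuous_intros cont')
  have P0: "k \<le> norm x \<Longrightarrow> P x = 0" and R0: "k \<le> norm x \<Longrightarrow> R x = 0" for x
    by (auto simp: P_def R_def \<Phi>)
  obtain C where C: "0 \<le> C" "\<And>x. norm x \<le> K' \<Longrightarrow> norm (H x) \<le> C"
  proof -
    have "compact (H ` cball 0 K')"
      by (intro compact_continuous_image continuous_on_subset[OF H_cont]) (use K' in auto)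
    then obtain C where "0 < C" "\<forall>y\<in>H ` cball 0 K'. norm y \<le> C"
      using compact_imp_bounded bounded_pos by blast
    then show ?thesis by (intro that[of C]) auto
  qed
  \<comment> \<open>By the mean value theorem a quotient is a value of the Hessian, hence bounded on
    the compact ball of radius \<open>K'\<close>. This gives the dominating function
    \<open>C * R\<close>.\<close>
  have q_bound: "\<bar>q n l x\<bar> \<le> C" if x: "norm x < k" and n: "h n \<le> K' - k" for n l x
  proof -
    obtain s where s: "0 < s" "s < h n"
      and eq: "G (x + h n *\<^sub>R ?e) $ l - G x $ l = h n * H (x + s *\<^sub>R ?e) $ l $ j"
    proof (rule pderiv_mean_value[of "h n" j "\<lambda>x. G x $ l" "\<lambda>x. H x $ l $ j" x])
      fix s assume "0 \<le> s" "s \<le> h n"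
      then show "has_pderiv j (\<lambda>x. G x $ l) (H (x + s *\<^sub>R ?e) $ l $ j) (x + s *\<^sub>R ?e)"
        using x K' by (intro G_pderiv shift[of x s n]) auto
    qed (use h in auto)
    have "\<bar>q n l x\<bar> = \<bar>H (x + s *\<^sub>R ?e) $ l $ j\<bar>"
      using eq h(1)[of n] by (simp add: q_def)
    also have "\<dots> \<le> norm (H (x + s *\<^sub>R ?e))"
      using component_le_norm_cart[of "H (x + s *\<^sub>R ?e) $ l" j] Finite_Cartesian_Product.norm_nth_le[of "H (x + s *\<^sub>R ?e)" l] by linarith
    also have "\<dots> \<le> C"
      using norm_triangle_ineq[of x "s *\<^sub>R ?e"] s x n by (intro C) auto
    finally show ?thesis .
  qed
  have "\<forall>\<^sub>F n in sequentially. h n < K' - k"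
    using h0 K' by (intro order_tendstoD(2)[OF h0]) auto
  then obtain n0 where n0: "\<And>n. n0 \<le> n \<Longrightarrow> h n \<le> K' - k"
    unfolding eventually_sequentially by (meson less_imp_le)
  have "(\<lambda>n. integral\<^sup>L lborel (Q (n + n0))) \<longlonglongrightarrow> integral\<^sup>L lborel P"
  proof (rule integral_dominated_convergence[where w = "\<lambda>x. C * R x"])
    show "P \<in> borel_measurable lborel"
      using P_cont by (simp add: borel_measurable_continuous_onI)
    show "Q (n + n0) \<in> borel_measurable lborel" for n
      using Q[of "n + n0"] by (auto simp: has_bochner_integral_iff)
    show "integrable lborel (\<lambda>x. C * R x)"
      using integrable_compact_support[OF R_cont R0] by simp
    show "AE x in lborel. (\<lambda>n. Q (n + n0) x) \<longlonglongrightarrow> P x"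
    proof (rule AE_I2)
      fix x :: "real^'n"
      show "(\<lambda>n. Q (n + n0) x) \<longlonglongrightarrow> P x"
      proof (cases "norm x < k")
        case True
        have hz: "filterlim h (at 0) sequentially"
          using h0 h(1) by (auto simp: filterlim_at less_imp_neq[symmetric] intro!: always_eventually)
        have ql: "(\<lambda>n. q n l x) \<longlonglongrightarrow> H x $ l $ j" for l
        proof -
          have "((\<lambda>t. (G (x + t *\<^sub>R ?e) $ l - G x $ l) / t) \<longlongrightarrow> H x $ l $ j) (at 0)"
            using G_pderiv[of x j l] True k unfolding has_pderiv_def DERIV_def by simp
          then show ?thesis unfolding q_def using hz by (rule filterlim_compose)
        qed
        have "(\<lambda>n. Q n x) \<longlonglongrightarrow> P x"
          unfolding Q_def P_def by (intro tendsto_intros ql)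
        then show ?thesis by (rule LIMSEQ_ignore_initial_segment)
      next
        case False
        then show ?thesis by (simp add: Q_def P_def \<Phi>)
      qed
    qed
    show "AE x in lborel. norm (Q (n + n0) x) \<le> C * R x" for n
    proof (rule AE_I2)
      fix x :: "real^'n"
      show "norm (Q (n + n0) x) \<le> C * R x"
      proof (cases "norm x < k")
        case True
        then have b: "\<bar>q (n + n0) l x\<bar> \<le> C" for l using n0[of "n + n0"] q_bound by auto
        have b': "\<bar>y * q (n + n0) l x\<bar> \<le> C * \<bar>y\<bar>" for y l
          using mult_right_mono[OF b abs_ge_zero, of l y] by (simp add: abs_mult mult.commute)
        have "Q (n + n0) x = \<Phi> x * H x $ i $ i * q (n + n0) j x - \<Phi> x * H x $ i $ j * q (n + n0) i x
           - G x $ i * \<Phi>' j x * q (n + n0) i x + G x $ i * \<Phi>' i x * q (n + n0) j x"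
          by (simp add: Q_def algebra_simps)
        then have "\<bar>Q (n + n0) x\<bar> \<le> C * \<bar>\<Phi> x * H x $ i $ i\<bar> + C * \<bar>\<Phi> x * H x $ i $ j\<bar>
            + C * \<bar>G x $ i * \<Phi>' j x\<bar> + C * \<bar>G x $ i * \<Phi>' i x\<bar>"
          using b'[of "\<Phi> x * H x $ i $ i" j] b'[of "\<Phi> x * H x $ i $ j" i] b'[of "G x $ i * \<Phi>' j x" i]
            b'[of "G x $ i * \<Phi>' i x" j] by linarith
        then show ?thesis by (simp add: R_def algebra_simps)
      next
        case False
        then show ?thesis by (simp add: Q_def R_def \<Phi>)
      qed
    qed
  qed
  moreover have "integral\<^sup>L lborel (Q (n + n0)) = 0" for n
    using Q[of "n + n0"] by (simp add: has_bochner_integral_iff)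
  ultimately have "integral\<^sup>L lborel P = 0" by (simp add: LIMSEQ_const_iff)
  then show ?thesis
    using integrable_compact_support[OF P_cont P0] unfolding P_def by (simp add: has_bochner_integral_iff)
qed

end

section \<open>Divergence identities with powers of a positive function as weights\<close>

locale positive_C2_ball = C2_ball K u G H
  for K :: real and u :: "real^'n::finite \<Rightarrow> real" and G H +
  assumes u_pos: "x \<in> ball 0 K \<Longrightarrow> 0 < u x"
begin

definition lap :: "real^'n \<Rightarrow> real" where "lap x = (\<Sum>i\<in>UNIV. H x $ i $ i)"
definition hess2 :: "real^'n \<Rightarrow> real" where "hess2 x = (\<Sum>i\<in>UNIV. \<Sum>j\<in>UNIV. (H x $ i $ j)\<^sup>2)"
definition hess_grad :: "real^'n \<Rightarrow> real" where
  "hess_grad x = (\<Sum>i\<in>UNIV. \<Sum>j\<in>UNIV. G x $ i * G x $ j * H x $ i $ j)"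
definition grad2 :: "real^'n \<Rightarrow> real" where "grad2 x = (\<Sum>i\<in>UNIV. (G x $ i)\<^sup>2)"

lemma grad2_eq: "grad2 x = (norm (G x))\<^sup>2"
  by (simp add: grad2_def norm_vec_def L2_set_def sum_nonneg)

lemma u_powr_pderiv:
  assumes "x \<in> ball 0 K"
  shows "has_pderiv i (\<lambda>x. u x powr r) (r * u x powr (r - 1) * G x $ i) x"
  by (intro has_pderiv_powr u_pderiv u_pos assms)

lemma grad2_pderiv:
  assumes "x \<in> ball 0 K"
  shows "has_pderiv i grad2 (2 * (\<Sum>j\<in>UNIV. G x $ j * H x $ i $ j)) x"
proof -
  have "has_pderiv i (\<lambda>x. \<Sum>j\<in>UNIV. G x $ j * G x $ j)
    (\<Sum>j\<in>UNIV. H x $ j $ i * G x $ j + H x $ j $ i * G x $ j) x"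
    by (intro has_pderiv_sum has_pderiv_mult G_pderiv assms)
  moreover have "(\<Sum>j\<in>UNIV. H x $ j $ i * G x $ j + H x $ j $ i * G x $ j)
    = 2 * (\<Sum>j\<in>UNIV. G x $ j * H x $ i $ j)"
    unfolding sum_distrib_left by (intro sum.cong) (auto simp: H_sym[OF assms, of i])
  ultimately show ?thesis
    by (simp add: grad2_def[abs_def] power2_eq_square)
qed

lemma u_powr_cont: "continuous_on (ball 0 K) (\<lambda>x. u x powr r)"
  using u_pos by (intro continuous_intros u_cont) force

lemma grad2_cont: "continuous_on (ball 0 K) grad2"
  unfolding grad2_def by (intro continuous_intros G_component_cont)

lemmas cont_rules = u_cont G_component_cont H_component_cont u_powr_cont grad2_cont

end

text \<open>Of the second derivatives of the cutoff only the pure ones are carried: beyond first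
  order it enters the identities through its Laplacian alone.\<close>

locale cutoff_ball = positive_C2_ball K u G H
  for K :: real and u :: "real^'n::finite \<Rightarrow> real" and G H +
  fixes k :: real and \<phi> :: "real^'n \<Rightarrow> real" and d\<phi> dd\<phi> :: "'n \<Rightarrow> real^'n \<Rightarrow> real"
  assumes k: "0 < k" "k < K"
    and phi_cont: "continuous_on UNIV \<phi>" "\<And>i. continuous_on UNIV (d\<phi> i)" "\<And>i. continuous_on UNIV (dd\<phi> i)"
    and phi_outside: "\<And>x. k \<le> norm x \<Longrightarrow> \<phi> x = 0" "\<And>i x. k \<le> norm x \<Longrightarrow> d\<phi> i x = 0"
      "\<And>i x. k \<le> norm x \<Longrightarrow> dd\<phi> i x = 0"
    and phi_pderiv: "\<And>i x. has_pderiv i \<phi> (d\<phi> i x) x"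
    and dphi_pderiv: "\<And>i x. has_pderiv i (d\<phi> i) (dd\<phi> i x) x"
begin

text \<open>The inner product of the gradients of \<phi> and u, named after the radial cutoff with
  which it is used.\<close>

definition radial :: "real^'n \<Rightarrow> real" where "radial x = (\<Sum>i\<in>UNIV. d\<phi> i x * G x $ i)"
definition mixed :: "real^'n \<Rightarrow> real" where
  "mixed x = (\<Sum>i\<in>UNIV. \<Sum>j\<in>UNIV. G x $ i * d\<phi> j x * H x $ i $ j)"
definition lap_phi :: "real^'n \<Rightarrow> real" where "lap_phi x = (\<Sum>i\<in>UNIV. dd\<phi> i x)"

lemmas phi_cont_ball = phi_cont[THEN continuous_on_subset[OF _ subset_UNIV]]

lemma outside: "x \<notin> ball 0 K \<Longrightarrow> \<phi> x = 0 \<and> d\<phi> i x = 0 \<and> dd\<phi> i x = 0"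
  using phi_outside k by auto

lemma radial_outside: "x \<notin> ball 0 K \<Longrightarrow> radial x = 0"
  and lap_phi_outside: "x \<notin> ball 0 K \<Longrightarrow> lap_phi x = 0"
  and mixed_outside: "x \<notin> ball 0 K \<Longrightarrow> mixed x = 0"
  using outside by (auto simp: radial_def lap_phi_def mixed_def)

text \<open>The weak Bochner identity: \<open>integral_hessian_minor\<close> with \<Phi> = \<phi>
  u^\<gamma>, summed over all ordered pairs of indices, since the sum of u_ii u_jj - u_ij^2 is (lap
  u)^2 - |D^2 u|^2.\<close>

lemma integral_hessian:
  "has_bochner_integral lborel (\<lambda>x. \<phi> x * u x powr \<gamma> * ((lap x)\<^sup>2 - hess2 x)
     - u x powr \<gamma> * mixed x - \<gamma> * (\<phi> x * u x powr (\<gamma> - 1) * hess_grad x)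
     + u x powr \<gamma> * radial x * lap x + \<gamma> * (\<phi> x * u x powr (\<gamma> - 1) * grad2 x * lap x)) 0"
proof -
  define \<Phi> where "\<Phi> x = \<phi> x * u x powr \<gamma>" for x
  define \<Phi>' where "\<Phi>' i x = d\<phi> i x * u x powr \<gamma> + \<phi> x * (\<gamma> * u x powr (\<gamma> - 1) * G x $ i)" for i x
  have "has_bochner_integral lborel (\<lambda>x. \<Sum>i\<in>UNIV. \<Sum>j\<in>UNIV.
      \<Phi> x * (H x $ i $ i * H x $ j $ j - H x $ i $ j * H x $ i $ j)
       - G x $ i * (\<Phi>' j x * H x $ i $ j - \<Phi>' i x * H x $ j $ j)) (\<Sum>i\<in>(UNIV::'n set). \<Sum>j\<in>(UNIV::'n set). 0)"
  proof (intro has_bochner_integral_sum integral_hessian_minor[OF k])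
    show "continuous_on (ball 0 K) \<Phi>" "continuous_on (ball 0 K) (\<Phi>' i)" for i
      unfolding \<Phi>_def \<Phi>'_def by (intro continuous_intros cont_rules phi_cont_ball)+
    show "has_pderiv i \<Phi> (\<Phi>' i x) x" if "x \<in> ball 0 K" for i x
      using has_pderiv_mult[OF phi_pderiv[of i x] u_powr_pderiv[OF that, of i \<gamma>]]
      by (simp add: \<Phi>_def[abs_def] \<Phi>'_def algebra_simps)
  qed (simp_all add: \<Phi>_def \<Phi>'_def phi_outside)
  moreover have "(\<Sum>i\<in>UNIV. \<Sum>j\<in>UNIV.
      \<Phi> x * (H x $ i $ i * H x $ j $ j - H x $ i $ j * H x $ i $ j)
       - G x $ i * (\<Phi>' j x * H x $ i $ j - \<Phi>' i x * H x $ j $ j)) =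
     \<phi> x * u x powr \<gamma> * ((lap x)\<^sup>2 - hess2 x)
     - u x powr \<gamma> * mixed x - \<gamma> * (\<phi> x * u x powr (\<gamma> - 1) * hess_grad x)
     + u x powr \<gamma> * radial x * lap x + \<gamma> * (\<phi> x * u x powr (\<gamma> - 1) * grad2 x * lap x)" for x
  proof -
    have 1: "(\<Sum>i\<in>UNIV. \<Sum>j\<in>UNIV. \<Phi> x * (H x $ i $ i * H x $ j $ j - H x $ i $ j * H x $ i $ j))
      = \<Phi> x * ((lap x)\<^sup>2 - hess2 x)"
      unfolding lap_def hess2_def power2_eq_square sum_product
      by (simp add: sum_distrib_left[symmetric] sum_subtractf)
    have 2: "(\<Sum>i\<in>UNIV. \<Sum>j\<in>UNIV. G x $ i * (\<Phi>' j x * H x $ i $ j))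
      = u x powr \<gamma> * mixed x + \<gamma> * (\<phi> x * u x powr (\<gamma> - 1) * hess_grad x)"
      unfolding mixed_def hess_grad_def \<Phi>'_def sum_distrib_left sum.distrib[symmetric]
      by (intro sum.cong refl) (simp add: algebra_simps)
    have "(\<Sum>i\<in>UNIV. \<Sum>j\<in>UNIV. G x $ i * (\<Phi>' i x * H x $ j $ j))
      = (\<Sum>i\<in>UNIV. G x $ i * \<Phi>' i x) * lap x"
      unfolding lap_def sum_product by (intro sum.cong refl) simp
    also have "(\<Sum>i\<in>UNIV. G x $ i * \<Phi>' i x) = u x powr \<gamma> * radial x + \<gamma> * (\<phi> x * u x powr (\<gamma> - 1) * grad2 x)"
      unfolding radial_def grad2_def \<Phi>'_def sum_distrib_left sum.distrib[symmetric]
      by (intro sum.cong refl) (simp add: algebra_simps power2_eq_square)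
    finally have 3: "(\<Sum>i\<in>UNIV. \<Sum>j\<in>UNIV. G x $ i * (\<Phi>' i x * H x $ j $ j)) = \<dots> * lap x" .
    have "(\<Sum>i\<in>UNIV. \<Sum>j\<in>UNIV.
      \<Phi> x * (H x $ i $ i * H x $ j $ j - H x $ i $ j * H x $ i $ j)
       - G x $ i * (\<Phi>' j x * H x $ i $ j - \<Phi>' i x * H x $ j $ j)) =
      (\<Sum>i\<in>UNIV. \<Sum>j\<in>UNIV. \<Phi> x * (H x $ i $ i * H x $ j $ j - H x $ i $ j * H x $ i $ j))
      - ((\<Sum>i\<in>UNIV. \<Sum>j\<in>UNIV. G x $ i * (\<Phi>' j x * H x $ i $ j))
         - (\<Sum>i\<in>UNIV. \<Sum>j\<in>UNIV. G x $ i * (\<Phi>' i x * H x $ j $ j)))"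
      unfolding sum_subtractf[symmetric] by (intro sum.cong refl) (simp add: algebra_simps)
    then show ?thesis
      unfolding 1 2 3 by (simp add: \<Phi>_def algebra_simps)
  qed
  ultimately show ?thesis by simp
qed

text \<open>The divergence of \<phi> u^r |grad u|^2 grad u. It is a second relation for
  \<open>hess_grad\<close>, and its coefficient \<open>t\<close> stays free in the
  combination.\<close>

lemma integral_grad2_grad:
  "has_bochner_integral lborel (\<lambda>x. u x powr r * grad2 x * radial x
     + r * (\<phi> x * u x powr (r - 1) * (grad2 x)\<^sup>2) + 2 * (\<phi> x * u x powr r * hess_grad x)
     + \<phi> x * u x powr r * grad2 x * lap x) 0"
proof -
  have "has_bochner_integral lborel (\<lambda>x. \<Sum>i\<in>UNIV. d\<phi> i x * u x powr r * grad2 x * G x $ i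
      + \<phi> x * (r * u x powr (r - 1) * G x $ i) * grad2 x * G x $ i
      + \<phi> x * u x powr r * (2 * (\<Sum>j\<in>UNIV. G x $ j * H x $ i $ j)) * G x $ i
      + \<phi> x * u x powr r * grad2 x * H x $ i $ i) (\<Sum>i\<in>(UNIV::'n set). 0)"
  proof (intro has_bochner_integral_sum integral_pderiv[OF k])
    fix i and x :: "real^'n" assume "x \<in> ball 0 K"
    from has_pderiv_mult[OF has_pderiv_mult[OF has_pderiv_mult[OF phi_pderiv[of i x]
      u_powr_pderiv[OF this, of i r]] grad2_pderiv[OF this, of i]] G_pderiv[OF this, of i i]]
    show "has_pderiv i (\<lambda>x. \<phi> x * u x powr r * grad2 x * G x $ i) (d\<phi> i x * u x powr r * grad2 x * G x $ i
      + \<phi> x * (r * u x powr (r - 1) * G x $ i) * grad2 x * G x $ i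
      + \<phi> x * u x powr r * (2 * (\<Sum>j\<in>UNIV. G x $ j * H x $ i $ j)) * G x $ i
      + \<phi> x * u x powr r * grad2 x * H x $ i $ i) x"
      by (rule has_pderiv_cong_value) (simp add: algebra_simps)
  qed (auto intro!: continuous_intros cont_rules phi_cont_ball simp: phi_outside)
  moreover have "(\<Sum>i\<in>UNIV. d\<phi> i x * u x powr r * grad2 x * G x $ i
      + \<phi> x * (r * u x powr (r - 1) * G x $ i) * grad2 x * G x $ i
      + \<phi> x * u x powr r * (2 * (\<Sum>j\<in>UNIV. G x $ j * H x $ i $ j)) * G x $ i
      + \<phi> x * u x powr r * grad2 x * H x $ i $ i) =
    u x powr r * grad2 x * radial x
     + r * (\<phi> x * u x powr (r - 1) * (grad2 x)\<^sup>2) + 2 * (\<phi> x * u x powr r * hess_grad x)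
     + \<phi> x * u x powr r * grad2 x * lap x" for x
  proof -
    have g: "(grad2 x)\<^sup>2 = (\<Sum>i\<in>UNIV. grad2 x * (G x $ i * G x $ i))"
      by (simp add: power2_eq_square[of "grad2 x"] sum_distrib_left[symmetric])
        (simp add: grad2_def power2_eq_square)
    show ?thesis
      unfolding g radial_def hess_grad_def lap_def sum_distrib_left sum.distrib[symmetric] sum_distrib_right
      by (intro sum.cong refl) (simp add: algebra_simps sum_distrib_left)
  qed
  ultimately show ?thesis by simp
qed

text \<open>The divergence of u^r |grad u|^2 grad \<phi>. It serves to remove \<open>mixed\<close>,
  the one term of \<open>integral_hessian\<close> in which the full Hessian meets derivatives of the
  cutoff.\<close>

lemma integral_grad2_grad_phi:
  "has_bochner_integral lborel (\<lambda>x. r * (u x powr (r - 1) * grad2 x * radial x)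
     + 2 * (u x powr r * mixed x) + u x powr r * grad2 x * lap_phi x) 0"
proof -
  have "has_bochner_integral lborel (\<lambda>x. \<Sum>i\<in>UNIV. r * u x powr (r - 1) * G x $ i * grad2 x * d\<phi> i x
      + u x powr r * (2 * (\<Sum>j\<in>UNIV. G x $ j * H x $ i $ j)) * d\<phi> i x
      + u x powr r * grad2 x * dd\<phi> i x) (\<Sum>i\<in>(UNIV::'n set). 0)"
  proof (intro has_bochner_integral_sum integral_pderiv[OF k])
    fix i and x :: "real^'n" assume "x \<in> ball 0 K"
    from has_pderiv_mult[OF has_pderiv_mult[OF
      u_powr_pderiv[OF this, of i r] grad2_pderiv[OF this, of i]] dphi_pderiv[of i x]]
    show "has_pderiv i (\<lambda>x. u x powr r * grad2 x * d\<phi> i x) (r * u x powr (r - 1) * G x $ i * grad2 x * d\<phi> i x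
      + u x powr r * (2 * (\<Sum>j\<in>UNIV. G x $ j * H x $ i $ j)) * d\<phi> i x
      + u x powr r * grad2 x * dd\<phi> i x) x"
      by (rule has_pderiv_cong_value) (simp add: algebra_simps)
  qed (auto intro!: continuous_intros cont_rules phi_cont_ball simp: phi_outside)
  moreover have "(\<Sum>i\<in>UNIV. r * u x powr (r - 1) * G x $ i * grad2 x * d\<phi> i x
      + u x powr r * (2 * (\<Sum>j\<in>UNIV. G x $ j * H x $ i $ j)) * d\<phi> i x
      + u x powr r * grad2 x * dd\<phi> i x) =
    r * (u x powr (r - 1) * grad2 x * radial x)
     + 2 * (u x powr r * mixed x) + u x powr r * grad2 x * lap_phi x" for x
  proof (cases "x \<in> ball 0 K")
    case True
    have m: "mixed x = (\<Sum>i\<in>UNIV. \<Sum>j\<in>UNIV. G x $ j * d\<phi> i x * H x $ i $ j)"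
      unfolding mixed_def by (subst sum.swap) (intro sum.cong refl, subst H_sym[OF True], simp)
    show ?thesis
      unfolding m radial_def lap_phi_def sum_distrib_left sum.distrib[symmetric] sum_distrib_right
      by (intro sum.cong refl) (simp add: algebra_simps sum_distrib_left)
  qed (simp add: outside radial_outside lap_phi_outside mixed_outside)
  ultimately show ?thesis by simp
qed

text \<open>The divergence of \<phi> u^r grad u. With r = \<gamma> + p and lap u close to -u^p it
  produces the term u^\<gamma> u^(2p) that is to be estimated.\<close>

lemma integral_powr_grad:
  "has_bochner_integral lborel (\<lambda>x. u x powr r * radial x
     + r * (\<phi> x * u x powr (r - 1) * grad2 x) + \<phi> x * u x powr r * lap x) 0"
proof -
  have "has_bochner_integral lborel (\<lambda>x. \<Sum>i\<in>UNIV. d\<phi> i x * u x powr r * G x $ i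
      + \<phi> x * (r * u x powr (r - 1) * G x $ i) * G x $ i
      + \<phi> x * u x powr r * H x $ i $ i) (\<Sum>i\<in>(UNIV::'n set). 0)"
  proof (intro has_bochner_integral_sum integral_pderiv[OF k])
    fix i and x :: "real^'n" assume "x \<in> ball 0 K"
    from has_pderiv_mult[OF has_pderiv_mult[OF phi_pderiv[of i x]
      u_powr_pderiv[OF this, of i r]] G_pderiv[OF this, of i i]]
    show "has_pderiv i (\<lambda>x. \<phi> x * u x powr r * G x $ i) (d\<phi> i x * u x powr r * G x $ i
      + \<phi> x * (r * u x powr (r - 1) * G x $ i) * G x $ i
      + \<phi> x * u x powr r * H x $ i $ i) x"
      by (rule has_pderiv_cong_value) (simp add: algebra_simps)
  qed (auto intro!: continuous_intros cont_rules phi_cont_ball simp: phi_outside)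
  moreover have "(\<Sum>i\<in>UNIV. d\<phi> i x * u x powr r * G x $ i
      + \<phi> x * (r * u x powr (r - 1) * G x $ i) * G x $ i
      + \<phi> x * u x powr r * H x $ i $ i) =
    u x powr r * radial x + r * (\<phi> x * u x powr (r - 1) * grad2 x) + \<phi> x * u x powr r * lap x" for x
    unfolding radial_def lap_def grad2_def sum_distrib_left sum.distrib[symmetric] sum_distrib_right
    by (intro sum.cong refl) (simp add: algebra_simps power2_eq_square)
  ultimately show ?thesis by simp
qed

text \<open>The coefficients \<open>1\<close> and \<open>1/2\<close> of the first and third identities are chosen so that the
  mixed terms \<open>u\<^sub>i \<phi>\<^sub>j u\<^sub>i\<^sub>j\<close> cancel.\<close>

lemma integral_combined:
  "has_bochner_integral lborel (\<lambda>x. u x powr \<gamma> * (\<phi> x * (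
      (lap x)\<^sup>2 - hess2 x - \<gamma> * (hess_grad x / u x) + \<gamma> * (grad2 x / u x) * lap x
      + t * (2 * (hess_grad x / u x) + (\<gamma> - 1) * (grad2 x / u x)\<^sup>2 + grad2 x / u x * lap x)
      + \<mu> * ((\<gamma> + p) * (grad2 x / u x) * u x powr p + u x powr p * lap x))
    + radial x * lap x + (t + \<gamma> / 2) * (grad2 x / u x) * radial x
    + grad2 x * lap_phi x / 2 + \<mu> * u x powr p * radial x)) 0"
    (is "has_bochner_integral _ ?f 0")
proof -
  let ?g = "\<lambda>x. (\<phi> x * u x powr \<gamma> * ((lap x)\<^sup>2 - hess2 x)
     - u x powr \<gamma> * mixed x - \<gamma> * (\<phi> x * u x powr (\<gamma> - 1) * hess_grad x)
     + u x powr \<gamma> * radial x * lap x + \<gamma> * (\<phi> x * u x powr (\<gamma> - 1) * grad2 x * lap x))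
    + t * (u x powr (\<gamma> - 1) * grad2 x * radial x
     + (\<gamma> - 1) * (\<phi> x * u x powr (\<gamma> - 1 - 1) * (grad2 x)\<^sup>2) + 2 * (\<phi> x * u x powr (\<gamma> - 1) * hess_grad x)
     + \<phi> x * u x powr (\<gamma> - 1) * grad2 x * lap x)
    + 1 / 2 * (\<gamma> * (u x powr (\<gamma> - 1) * grad2 x * radial x)
     + 2 * (u x powr \<gamma> * mixed x) + u x powr \<gamma> * grad2 x * lap_phi x)
    + \<mu> * (u x powr (\<gamma> + p) * radial x
     + (\<gamma> + p) * (\<phi> x * u x powr (\<gamma> + p - 1) * grad2 x) + \<phi> x * u x powr (\<gamma> + p) * lap x)"
  have "has_bochner_integral lborel ?g (0 + t * 0 + 1 / 2 * 0 + \<mu> * 0)"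
    by (intro has_bochner_integral_add has_bochner_integral_mult_right integral_hessian
        integral_grad2_grad integral_grad2_grad_phi integral_powr_grad)
  \<comment> \<open>Lowering an exponent by 1 is division by \<open>u x\<close> only where
    \<open>u x\<close> is positive, as in the ball; beyond it every term contains \<phi> or one of
    its derivatives and is 0.\<close>
  moreover have "?g x = ?f x" for x
  proof (cases "x \<in> ball 0 K")
    case True
    then have u: "0 < u x" by (rule u_pos)
    have e: "u x powr (\<gamma> - 1) = u x powr \<gamma> / u x" "u x powr (\<gamma> - 1 - 1) = u x powr \<gamma> / u x / u x"
      "u x powr (\<gamma> + p) = u x powr \<gamma> * u x powr p" "u x powr (\<gamma> + p - 1) = u x powr \<gamma> * u x powr p / u x"
      using u by (simp_all add: powr_diff powr_add power2_eq_square[of "u x", symmetric] flip: diff_diff_eq)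
    show ?thesis
      unfolding e by (simp add: algebra_simps power2_eq_square)
  next
    case False
    then show ?thesis by (simp add: outside radial_outside lap_phi_outside mixed_outside)
  qed
  ultimately show ?thesis by simp
qed

end

section \<open>The pointwise inequality\<close>

text \<open>To be read with A = |grad u|^2 / u, B = u^p, L = lap u, h = |D^2 u|^2 and q = u_i u_j
  u_ij / u. The trace inequality with b = \<gamma>/2 - t removes \<open>h\<close> and
  \<open>q\<close> at once, and inserting L = -B leaves a form in A and B. Its B^2 coefficient asks
  for \<mu> > 1 - 1/n; its AB coefficient, for \<mu> close to that value, asks for t > (n-1)p/(n+2);
  its A^2 coefficient asks for t < (n-1)/(n-2). The two conditions on positive \<open>t\<close> are
  compatible exactly when p < (n+2)/(n-2).\<close>

lemma gidas_spruck_exponents: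
  fixes n p :: real
  assumes n: "3 \<le> n" and p: "1 < p" "p < (n + 2) / (n - 2)"
  obtains t \<gamma> \<mu> c e where "0 < c" "0 < e" "e \<le> 1" "0 < \<gamma> + 2" "n < 2 * (\<gamma> + 2 * p) / (p - 1)"
    "\<And>A B L h q. 0 \<le> A \<Longrightarrow> 0 \<le> B \<Longrightarrow> \<bar>L + B\<bar> \<le> e * (A + B) \<Longrightarrow>
      (L + (\<gamma> / 2 - t) * A)\<^sup>2 / n \<le> h + 2 * (\<gamma> / 2 - t) * q + (\<gamma> / 2 - t)\<^sup>2 * A\<^sup>2 \<Longrightarrow>
      L\<^sup>2 - h - \<gamma> * q + \<gamma> * A * L + t * (2 * q + (\<gamma> - 1) * A\<^sup>2 + A * L)
        + \<mu> * ((\<gamma> + p) * A * B + B * L) \<le> - c * (A + B)\<^sup>2"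
proof -
  define t where "t = ((n - 1) * p / (n + 2) + (n - 1) / (n - 2)) / 2"
  \<comment> \<open>For given \<open>t\<close> this value minimizes the A^2 coefficient t(\<gamma> -
    1) + (1 - 1/n)(\<gamma>/2 - t)^2, which becomes \<open>- \<alpha>\<close>.\<close>
  define \<gamma> where "\<gamma> = - 2 * t / (n - 1)"
  have "p * (n - 2) < n + 2" using p n by (simp add: field_simps)
  then have "(n - 1) * (p * (n - 2)) < (n - 1) * (n + 2)" using n by (intro mult_strict_left_mono) auto
  then have "(n - 1) * p / (n + 2) < (n - 1) / (n - 2)" using n by (simp add: field_simps)
  moreover have "x < y \<Longrightarrow> x < (x + y) / 2 \<and> (x + y) / 2 < y" for x y :: real by simp
  ultimately have "(n - 1) * p / (n + 2) < t" "t < (n - 1) / (n - 2)"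
    unfolding t_def by blast+
  then have t1: "(n - 1) * p < t * (n + 2)" and t2: "t * (n - 2) < n - 1"
    using n by (auto simp: field_simps)
  have "0 < (n - 1) * p" using n p by (intro mult_pos_pos) auto
  with t1 have "0 < t * (n + 2)" by linarith
  then have t0: "0 < t" using n by (simp add: zero_less_mult_iff)
  \<comment> \<open>The slack of \<open>t\<close> in the AB coefficient is spent on
    \<open>\<mu>\<close>: raising it by \<open>\<eta>\<close> makes the B^2 coefficient equal to
    \<open>- \<eta>\<close> and keeps the AB coefficient nonpositive.\<close>
  define \<eta> where "\<eta> = (t * (n + 2) - (n - 1) * p) / (n * (\<bar>\<gamma> + p\<bar> + 1))"
  have \<eta>: "0 < \<eta>" unfolding \<eta>_def using t1 n by (intro divide_pos_pos mult_pos_pos) auto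
  define \<mu> where "\<mu> = 1 - 1 / n + \<eta>"
  have "1 / n \<le> 1" using n by simp
  then have \<mu>0: "0 < \<mu>" using \<eta> by (simp add: \<mu>_def)
  define \<alpha> where "\<alpha> = t - t\<^sup>2 * (n - 2) / (n - 1)"
  have "t * (t * (n - 2)) < t * (n - 1)" using t2 t0 by (intro mult_strict_left_mono)
  then have \<alpha>: "0 < \<alpha>" using n by (simp add: \<alpha>_def field_simps power2_eq_square)
  define c0 where "c0 = min \<eta> \<alpha>"
  \<comment> \<open>Sum of the coefficients of d^2, B d and A d in the error, where d = L + B. With
    \<open>e * C \<le> c0 / 4\<close> the error costs half of the available c0/2 times (A +
    B)^2.\<close>
  define C where "C = 3 + t + \<mu>"
  have c0: "0 < c0" and C: "0 < C" using \<eta> \<alpha> t0 \<mu>0 by (auto simp: c0_def C_def)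
  define e where "e = min 1 (c0 / (4 * C))"
  have e: "0 < e" "e \<le> 1" "e * C \<le> c0 / 4"
  proof -
    show "0 < e" "e \<le> 1" using c0 C by (auto simp: e_def)
    have "e * C \<le> c0 / (4 * C) * C" using C by (intro mult_right_mono) (auto simp: e_def)
    then show "e * C \<le> c0 / 4" using C by simp
  qed
  have \<gamma>n: "- 2 / (n - 2) < \<gamma>"
    using t2 n by (simp add: \<gamma>_def field_simps)
  have "2 / (n - 2) \<le> 2" using n by (simp add: field_simps)
  then have \<gamma>2: "0 < \<gamma> + 2" using \<gamma>n by simp
  \<comment> \<open>Both bounds enter at their extremes: \<gamma> > -2/(n-2), which comes from t <
    (n-1)/(n-2), and p - 1 < 4/(n-2). The sign of n - 4 decides whether the second one may be
    multiplied in.\<close>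
  have sig: "n < 2 * (\<gamma> + 2 * p) / (p - 1)"
  proof -
    define s where "s = p - 1"
    have s: "0 < s" "s * (n - 2) < 4" using p n by (auto simp: s_def field_simps)
    have "(n - 4) * s \<le> 4 - 4 / (n - 2)"
    proof (cases "4 \<le> n")
      case True
      have "s \<le> 4 / (n - 2)" using s n by (simp add: field_simps)
      then have "(n - 4) * s \<le> (n - 4) * (4 / (n - 2))" using True by (intro mult_left_mono) auto
      also have "\<dots> \<le> 4 - 4 / (n - 2)" using n by (simp add: field_simps)
      finally show ?thesis .
    next
      case False
      then have "(n - 4) * s \<le> 0" using s by (intro mult_nonpos_nonneg) auto
      also have "0 \<le> 4 - 4 / (n - 2)" using n by (simp add: field_simps)
      finally show ?thesis .
    qed
    moreover have "2 * \<gamma> > - (4 / (n - 2))" using \<gamma>n by simp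
    ultimately have "n * s < 2 * (\<gamma> + 2 * (1 + s))" by (simp add: algebra_simps)
    then show ?thesis using s by (simp add: s_def field_simps)
  qed
  have main: "L\<^sup>2 - h - \<gamma> * q + \<gamma> * A * L + t * (2 * q + (\<gamma> - 1) * A\<^sup>2 + A * L)
        + \<mu> * ((\<gamma> + p) * A * B + B * L) \<le> - (c0 / 4) * (A + B)\<^sup>2"
    if AB: "0 \<le> A" "0 \<le> B" and L: "\<bar>L + B\<bar> \<le> e * (A + B)"
      and h: "(L + (\<gamma> / 2 - t) * A)\<^sup>2 / n \<le> h + 2 * (\<gamma> / 2 - t) * q + (\<gamma> / 2 - t)\<^sup>2 * A\<^sup>2"
    for A B L h q :: real
  proof -
    define d where "d = L + B"
    define b where "b = \<gamma> / 2 - t"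
    have b: "b = - (t * n / (n - 1))" using n by (simp add: b_def \<gamma>_def field_simps)
    have "b / n = - (t / (n - 1))" using n by (simp add: b)
    then have \<kappa>: "\<gamma> + t - 2 * b / n = t" by (simp add: \<gamma>_def)
    have \<alpha>': "t * (\<gamma> - 1) + b\<^sup>2 - b\<^sup>2 / n = - \<alpha>"
      using n unfolding b \<gamma>_def \<alpha>_def by (simp add: divide_simps) (simp add: algebra_simps power2_eq_square)
    have "L\<^sup>2 - h - \<gamma> * q + \<gamma> * A * L + t * (2 * q + (\<gamma> - 1) * A\<^sup>2 + A * L)
        + \<mu> * ((\<gamma> + p) * A * B + B * L)
      \<le> L\<^sup>2 - ((L + b * A)\<^sup>2 / n - b\<^sup>2 * A\<^sup>2) + (2 * b - \<gamma> + 2 * t) * q + (\<gamma> + t) * A * L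
         + t * (\<gamma> - 1) * A\<^sup>2 + \<mu> * ((\<gamma> + p) * A * B + B * L)"
      using h unfolding b_def[symmetric] by (simp add: algebra_simps)
    also have "2 * b - \<gamma> + 2 * t = 0" by (simp add: b_def)
    also have "L\<^sup>2 - ((L + b * A)\<^sup>2 / n - b\<^sup>2 * A\<^sup>2) + 0 * q + (\<gamma> + t) * A * L
         + t * (\<gamma> - 1) * A\<^sup>2 + \<mu> * ((\<gamma> + p) * A * B + B * L)
      = (1 - 1 / n) * L\<^sup>2 + (\<gamma> + t - 2 * b / n) * (A * L) + (t * (\<gamma> - 1) + b\<^sup>2 - b\<^sup>2 / n) * A\<^sup>2
         + \<mu> * ((\<gamma> + p) * A * B + B * L)"
      by (simp add: algebra_simps power2_eq_square add_divide_distrib)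
    also have "\<dots> = (1 - 1 / n) * L\<^sup>2 + t * (A * L) - \<alpha> * A\<^sup>2 + \<mu> * ((\<gamma> + p) * A * B + B * L)"
      unfolding \<kappa> \<alpha>' by simp
    also have "\<dots> = - \<eta> * B\<^sup>2 + (\<mu> * (\<gamma> + p) - t) * (A * B) - \<alpha> * A\<^sup>2
        + ((1 - 1 / n) * (d * d) + (1 - 1 / n) * (- 2 * (B * d)) + t * (A * d) + \<mu> * (B * d))"
      by (simp add: d_def \<mu>_def algebra_simps power2_eq_square add_divide_distrib)
    also have "(\<mu> * (\<gamma> + p) - t) * (A * B) \<le> 0"
    proof -
      have "\<eta> * (\<gamma> + p) \<le> \<eta> * (\<bar>\<gamma> + p\<bar> + 1)" using \<eta> by (intro mult_left_mono) auto
      also have "\<dots> = (t * (n + 2) - (n - 1) * p) / n" by (simp add: \<eta>_def add_nonneg_eq_0_iff)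
      finally have "\<mu> * (\<gamma> + p) - t \<le> (1 - 1 / n) * (\<gamma> + p) + (t * (n + 2) - (n - 1) * p) / n - t"
        by (simp add: \<mu>_def algebra_simps)
      also have "\<dots> = 0"
        using n unfolding \<gamma>_def by (simp add: divide_simps) (simp add: algebra_simps)
      finally show ?thesis using AB by (intro mult_nonpos_nonneg) auto
    qed
    also have "(1 - 1 / n) * (d * d) + (1 - 1 / n) * (- 2 * (B * d)) + t * (A * d) + \<mu> * (B * d)
      \<le> (c0 / 4) * (A + B)\<^sup>2"
    proof -
      define S where "S = A + B"
      have S: "0 \<le> S" "A \<le> S" "B \<le> S" using AB by (auto simp: S_def)
      have d: "\<bar>d\<bar> \<le> e * S" using L by (simp add: d_def S_def)
      also have "e * S \<le> 1 * S" using e S by (intro mult_right_mono) auto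
      finally have d1: "\<bar>d\<bar> \<le> S" by simp
      have X: "\<bar>y * d\<bar> \<le> e * S\<^sup>2" if "\<bar>y\<bar> \<le> S" for y
      proof -
        have "\<bar>y\<bar> * \<bar>d\<bar> \<le> S * (e * S)" using that d S by (intro mult_mono) auto
        then show ?thesis by (simp add: abs_mult power2_eq_square mult.left_commute)
      qed
      have Bd: "\<bar>B * d\<bar> \<le> e * S\<^sup>2" "\<bar>A * d\<bar> \<le> e * S\<^sup>2" "\<bar>d * d\<bar> \<le> e * S\<^sup>2"
        using X[of B] X[of A] X[of d] AB S d1 by simp_all
      have n1: "0 \<le> 1 - 1 / n" "1 - 1 / n \<le> 1" using n by (auto simp: field_simps)
      have "(1 - 1 / n) * (d * d) \<le> 1 * (d * d)"
        using n1 by (intro mult_right_mono) auto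
      moreover have "d * d \<le> e * S\<^sup>2" using Bd by simp
      moreover have "(1 - 1 / n) * (- 2 * (B * d)) \<le> (1 - 1 / n) * (2 * (e * S\<^sup>2))"
        using Bd n1 by (intro mult_left_mono) auto
      moreover have "(1 - 1 / n) * (2 * (e * S\<^sup>2)) \<le> 1 * (2 * (e * S\<^sup>2))"
        using e n1 by (intro mult_right_mono) auto
      moreover have "t * (A * d) \<le> t * (e * S\<^sup>2)" using Bd t0 by (intro mult_left_mono) auto
      moreover have "\<mu> * (B * d) \<le> \<mu> * (e * S\<^sup>2)" using Bd \<mu>0 by (intro mult_left_mono) auto
      ultimately have "(1 - 1 / n) * (d * d) + (1 - 1 / n) * (- 2 * (B * d)) + t * (A * d) + \<mu> * (B * d)
        \<le> (e * C) * S\<^sup>2" by (simp add: C_def algebra_simps)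
      also have "\<dots> \<le> (c0 / 4) * S\<^sup>2" using e by (intro mult_right_mono) auto
      finally show ?thesis by (simp add: S_def)
    qed
    also have "- \<eta> * B\<^sup>2 + 0 - \<alpha> * A\<^sup>2 + (c0 / 4) * (A + B)\<^sup>2 \<le> - (c0 / 4) * (A + B)\<^sup>2"
    proof -
      have "c0 * B\<^sup>2 \<le> \<eta> * B\<^sup>2" "c0 * A\<^sup>2 \<le> \<alpha> * A\<^sup>2"
        by (auto simp: c0_def intro!: mult_right_mono)
      moreover have "c0 * (A + B)\<^sup>2 \<le> c0 * (2 * (A\<^sup>2 + B\<^sup>2))"
        using c0 zero_le_power2[of "A - B"]
        by (intro mult_left_mono) (auto simp: power2_eq_square algebra_simps)
      ultimately show ?thesis by (simp add: algebra_simps)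
    qed
    finally show ?thesis by simp
  qed
  show ?thesis
    by (rule that[of "c0 / 4" e \<gamma> t \<mu>]) (use c0 e \<gamma>2 sig main in auto)
qed

text \<open>Young's inequality as a dichotomy. If u/z^2 \<le> \<delta> S, the left side is absorbed.
  Otherwise u^p \<le> S < u/(\<delta> z^2) bounds u by a power of z, and \<gamma> + 2 > 0 carries
  this bound over to u^(\<gamma>+2). The exponent of z, namely 2(\<gamma>+2)/(p-1) + 4, is the decay
  rate \<sigma> of the integral estimate.\<close>

lemma powr_absorption:
  fixes p \<gamma> :: real
  assumes p: "1 < p" and \<gamma>: "0 < \<gamma> + 2" and \<delta>: "0 < \<delta>"
  obtains D where "0 < D" "\<And>u S z. 0 < u \<Longrightarrow> u powr p \<le> S \<Longrightarrow> 0 < z \<Longrightarrow>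
    u powr \<gamma> * (S * u / z\<^sup>2) \<le> \<delta> * (u powr \<gamma> * S\<^sup>2) + D * z powr (- (2 * (\<gamma> + 2 * p) / (p - 1)))"
proof
  define D where "D = \<delta> powr (- ((\<gamma> + 2) / (p - 1))) / \<delta>"
  show "0 < D" using \<delta> by (simp add: D_def)
  fix u S z :: real assume u: "0 < u" and S: "u powr p \<le> S" and z: "0 < z"
  have S0: "0 < S" using u S by (smt (verit) powr_gt_zero)
  show "u powr \<gamma> * (S * u / z\<^sup>2) \<le> \<delta> * (u powr \<gamma> * S\<^sup>2) + D * z powr (- (2 * (\<gamma> + 2 * p) / (p - 1)))"
  proof (cases "u / z\<^sup>2 \<le> \<delta> * S")
    case True
    have "S * (u / z\<^sup>2) \<le> S * (\<delta> * S)" by (rule mult_left_mono[OF True less_imp_le[OF S0]])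
    then have "u powr \<gamma> * (S * (u / z\<^sup>2)) \<le> u powr \<gamma> * (S * (\<delta> * S))"
      by (rule mult_left_mono) simp
    also have "\<dots> = \<delta> * (u powr \<gamma> * S\<^sup>2)" by (simp add: power2_eq_square)
    finally have "u powr \<gamma> * (S * u / z\<^sup>2) \<le> \<delta> * (u powr \<gamma> * S\<^sup>2)" by simp
    moreover have "0 \<le> D * z powr (- (2 * (\<gamma> + 2 * p) / (p - 1)))" using \<open>0 < D\<close> by simp
    ultimately show ?thesis by linarith
  next
    case False
    then have S1: "S < u / (\<delta> * z\<^sup>2)" using \<delta> z by (simp add: field_simps)
    then have "u powr p < u / (\<delta> * z\<^sup>2)" using S by linarith
    then have "u powr (p - 1) < inverse (\<delta> * z\<^sup>2)"
      using u by (simp add: powr_diff field_simps)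
    then have "(u powr (p - 1)) powr ((\<gamma> + 2) / (p - 1)) \<le> inverse (\<delta> * z\<^sup>2) powr ((\<gamma> + 2) / (p - 1))"
      using p \<gamma> by (intro powr_mono2) auto
    moreover have "(u powr (p - 1)) powr ((\<gamma> + 2) / (p - 1)) = u powr (\<gamma> + 2)"
      using p by (simp add: powr_powr)
    moreover have "inverse (\<delta> * z\<^sup>2) powr ((\<gamma> + 2) / (p - 1)) =
       \<delta> powr (- ((\<gamma> + 2) / (p - 1))) * z powr (- (2 * ((\<gamma> + 2) / (p - 1))))"
    proof -
      have "inverse (\<delta> * z\<^sup>2) = \<delta> powr (-1) * z powr (-2)"
        using \<delta> z by (simp add: powr_minus)
      then show ?thesis by (simp only: powr_powr powr_mult mult_minus_left mult_1)
    qed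
    ultimately have U: "u powr (\<gamma> + 2) \<le> \<delta> powr (- ((\<gamma> + 2) / (p - 1))) * z powr (- (2 * ((\<gamma> + 2) / (p - 1))))"
      by simp
    have z4: "z powr (-4) = 1 / z ^ 4" using z by (simp add: powr_minus divide_inverse)
    have "S * (u / z\<^sup>2) \<le> (u / (\<delta> * z\<^sup>2)) * (u / z\<^sup>2)" using S1 u z by (intro mult_right_mono) auto
    also have "\<dots> = u\<^sup>2 * (1 / \<delta>) * z powr (-4)"
      unfolding z4 by (simp add: power2_eq_square power4_eq_xxxx)
    finally have "u powr \<gamma> * (S * (u / z\<^sup>2)) \<le> u powr \<gamma> * (u\<^sup>2 * (1 / \<delta>) * z powr (-4))"
      by (intro mult_left_mono) auto
    also have "\<dots> = u powr (\<gamma> + 2) * ((1 / \<delta>) * z powr (-4))"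
      using u by (simp add: powr_add)
    also have "\<dots> \<le> \<delta> powr (- ((\<gamma> + 2) / (p - 1))) * z powr (- (2 * ((\<gamma> + 2) / (p - 1)))) * ((1 / \<delta>) * z powr (-4))"
      using U \<delta> by (intro mult_right_mono) auto
    also have "\<dots> = D * (z powr (- (2 * ((\<gamma> + 2) / (p - 1)))) * z powr (-4))"
      by (simp add: D_def)
    also have "z powr (- (2 * ((\<gamma> + 2) / (p - 1)))) * z powr (-4) = z powr (- (2 * (\<gamma> + 2 * p) / (p - 1)))"
    proof -
      have "- (2 * ((\<gamma> + 2) / (p - 1))) + - 4 = - (2 * (\<gamma> + 2 * p) / (p - 1))"
        using p by (simp add: field_simps)
      then show ?thesis by (simp add: powr_add[symmetric])
    qed
    finally have "u powr \<gamma> * (S * u / z\<^sup>2) \<le> D * z powr (- (2 * (\<gamma> + 2 * p) / (p - 1)))" by simp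
    also have "\<dots> \<le> \<delta> * (u powr \<gamma> * S\<^sup>2) + \<dots>" using \<delta> by simp
    finally show ?thesis .
  qed
qed

text \<open>Let S be the right side. Then u \<le> S^(1/p), hence g^2 \<le> S u \<le> S^((p+1)/p),
  and the power p/(p+1) of this gives exactly the exponent q.\<close>

lemma gradient_term_bound:
  fixes p g u :: real
  assumes p: "1 < p" and u: "0 < u" and g: "0 \<le> g"
  shows "g powr (2 * p / (p + 1)) \<le> g\<^sup>2 / u + u powr p"
proof (cases "g = 0")
  case False
  define S where "S = g\<^sup>2 / u + u powr p"
  have S0: "0 < S" using False u by (simp add: S_def add_nonneg_pos)
  have "u = (u powr p) powr (1 / p)" using p u by (simp add: powr_powr)
  also have "\<dots> \<le> S powr (1 / p)" using p u by (intro powr_mono2) (auto simp: S_def)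
  finally have "u \<le> S powr (1 / p)" .
  then have "g\<^sup>2 / u * u \<le> S * S powr (1 / p)"
    using S0 u by (intro mult_mono) (auto simp: S_def)
  also have "S * S powr (1 / p) = S powr ((p + 1) / p)"
    using S0 p by (simp add: powr_add[symmetric] powr_mult_base add_divide_distrib)
  finally have "g powr 2 \<le> S powr ((p + 1) / p)" using u g False by simp
  then have "(g powr 2) powr (p / (p + 1)) \<le> (S powr ((p + 1) / p)) powr (p / (p + 1))"
    using p by (intro powr_mono2) auto
  then show ?thesis using S0 p by (simp add: powr_powr S_def[symmetric] del: powr_numeral)
qed (use u in simp)

text \<open>Cauchy-Schwarz for the trace of D^2 u + (b/u) grad u (x) grad u, whose squared Frobenius
  norm is the right side. The rank-one correction is what allows the term \<open>hess_grad\<close>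
  to be removed later.\<close>

lemma (in positive_C2_ball) hessian_trace_inequality:
  "(lap x + b * (grad2 x / u x))\<^sup>2 / real CARD('n)
   \<le> hess2 x + 2 * b * (hess_grad x / u x) + b\<^sup>2 * (grad2 x / u x)\<^sup>2"
proof -
  define c where "c = b / u x"
  let ?a = "\<lambda>i j. H x $ i $ j + c * (G x $ i * G x $ j)"
  have "lap x + b * (grad2 x / u x) = (\<Sum>i\<in>UNIV. ?a i i)"
    by (simp add: lap_def grad2_def c_def sum.distrib sum_distrib_left power2_eq_square sum_divide_distrib)
  then have "(lap x + b * (grad2 x / u x))\<^sup>2 \<le> (\<Sum>i\<in>UNIV. (?a i i)\<^sup>2) * real CARD('n)"
    using sum_squared_le_sum_of_squares[of "\<lambda>i. ?a i i" UNIV] by simp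
  also have "\<dots> \<le> (\<Sum>i\<in>UNIV. \<Sum>j\<in>UNIV. (?a i j)\<^sup>2) * real CARD('n)"
    by (intro mult_right_mono sum_mono member_le_sum[where f = "\<lambda>j. (?a _ j)\<^sup>2"]) auto
  also have "(\<Sum>i\<in>UNIV. \<Sum>j\<in>UNIV. (?a i j)\<^sup>2) = hess2 x + 2 * c * hess_grad x + c\<^sup>2 * (grad2 x)\<^sup>2"
  proof -
    have g2: "(grad2 x)\<^sup>2 = (\<Sum>i\<in>UNIV. \<Sum>j\<in>UNIV. (G x $ i)\<^sup>2 * (G x $ j)\<^sup>2)"
      by (simp add: grad2_def power2_eq_square[of "sum _ _"] sum_product)
    show ?thesis
      unfolding hess2_def hess_grad_def g2 sum_distrib_left sum.distrib[symmetric]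
      by (intro sum.cong refl) (simp add: power2_eq_square algebra_simps)
  qed
  finally show ?thesis by (simp add: c_def divide_le_eq power_divide power_mult_distrib)
qed

section \<open>The integral estimate\<close>

lemma DERIV_pos_part_power:
  "((\<lambda>s::real. max 0 s ^ Suc (Suc m)) has_real_derivative real (m + 2) * max 0 s ^ Suc m) (at s)"
proof -
  consider "0 < s" | "s < 0" | "s = 0" by linarith
  then show ?thesis
  proof cases
    case 1
    have "((\<lambda>s::real. s ^ Suc (Suc m)) has_real_derivative real (m + 2) * max 0 s ^ Suc m) (at s)"
      using DERIV_pow[of "Suc (Suc m)" s] 1 by simp
    then show ?thesis
      by (rule has_field_derivative_transform_within_open[where S = "{0<..}"]) (use 1 in auto)
  next
    case 2
    have "((\<lambda>s::real. 0) has_real_derivative real (m + 2) * max 0 s ^ Suc m) (at s)"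
      using 2 by simp
    then show ?thesis
      by (rule has_field_derivative_transform_within_open[where S = "{..<0}"]) (use 2 in auto)
  next
    case 3
    have "isCont (\<lambda>h::real. max 0 h ^ Suc m) 0" by (intro continuous_intros)
    then have "((\<lambda>h::real. max 0 h ^ Suc m) \<longlongrightarrow> 0) (at 0)" by (simp add: isCont_def)
    then have "((\<lambda>h::real. max 0 h ^ Suc (Suc m) / h) \<longlongrightarrow> 0) (at 0)"
      by (rule tendsto_cong[THEN iffD1, rotated])
        (auto simp: eventually_at_filter max_def intro!: always_eventually)
    then show ?thesis using 3 by (simp add: DERIV_def)
  qed
qed

lemma continuous_cutoff_base: "continuous_on UNIV (\<lambda>x::real^'n::finite. max 0 (1 - (x \<bullet> x) / k\<^sup>2) ^ j)"
  by (cases "k = 0") (auto intro!: continuous_intros)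

text \<open>Each derivative lowers the exponent of the base \<zeta> by one and costs a factor of
  order 1/k, so the derivatives of \<phi> are controlled by \<phi> divided by powers of k\<zeta>.
  This is the form that \<open>powr_absorption\<close> can handle.\<close>

lemma has_pderiv_cutoff_power:
  fixes x :: "real^'n::finite"
  shows "has_pderiv i (\<lambda>x. max 0 (1 - (x \<bullet> x) / k\<^sup>2) ^ Suc (Suc m))
    (- (2 * real (m + 2) / k\<^sup>2) * (x $ i * max 0 (1 - (x \<bullet> x) / k\<^sup>2) ^ Suc m)) x"
proof -
  have "(x + t *\<^sub>R axis i 1) \<bullet> (x + t *\<^sub>R axis i 1) = x \<bullet> x + 2 * x $ i * t + t * t" for t
    by (simp add: inner_add_left inner_add_right inner_axis inner_axis' algebra_simps)
  moreover have "((\<lambda>t. x \<bullet> x + 2 * x $ i * t + t * t) has_real_derivative 2 * x $ i) (at 0)"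
    by (auto intro!: derivative_eq_intros)
  ultimately have "((\<lambda>t. 1 - ((x + t *\<^sub>R axis i 1) \<bullet> (x + t *\<^sub>R axis i 1)) / k\<^sup>2) has_real_derivative
      0 - 2 * x $ i / k\<^sup>2) (at 0)"
    by (intro DERIV_diff DERIV_const DERIV_cdivide) simp
  from DERIV_chain2[OF DERIV_pos_part_power this, of m]
  show ?thesis unfolding has_pderiv_def by (rule DERIV_cong) (simp add: algebra_simps add_divide_distrib)
qed

locale solution_ball = positive_C2_ball K u G H
  for K :: real and u :: "real^'n::finite \<Rightarrow> real" and G H +
  fixes p q M :: real
  assumes equation: "x \<in> ball 0 K \<Longrightarrow> - lap x = u x powr p + M * norm (G x) powr q"

text \<open>The bound for the integral of u^s is stated already combined with u \<ge> \<kappa> on a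
  ball. In this form only indicators of balls and \<open>Z\<close>, whose integral is 0, have to be
  integrated.\<close>

lemma integral_estimate:
  fixes p :: real
  assumes n: "3 \<le> CARD('n::finite)"
    and p: "1 < p" "p < (real CARD('n) + 2) / (real CARD('n) - 2)"
  obtains e s \<sigma> C where "0 < e" "0 < s" "real CARD('n) < \<sigma>" "0 < C"
    "\<And>M k K (u :: real^'n \<Rightarrow> real) G H y \<rho> \<kappa>. \<bar>M\<bar> \<le> e \<Longrightarrow> 0 < k \<Longrightarrow> k < K \<Longrightarrow>
      solution_ball K u G H p (2 * p / (p + 1)) M \<Longrightarrow> ball y \<rho> \<subseteq> ball 0 (k / 2) \<Longrightarrow> 0 < \<rho> \<Longrightarrow> 0 < \<kappa> \<Longrightarrow>
      (\<And>x. x \<in> ball y \<rho> \<Longrightarrow> \<kappa> \<le> u x) \<Longrightarrow>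
      \<kappa> powr s * \<rho> ^ CARD('n) \<le> C * k powr (real CARD('n) - \<sigma>)"
proof -
  define n where "n = real CARD('n)"
  have n3: "3 \<le> n" using n by (simp add: n_def)
  have p2: "p < (n + 2) / (n - 2)" using p by (simp add: n_def)
  obtain t \<gamma> \<mu> c e where c: "0 < c" and e: "0 < e" "e \<le> 1" and \<gamma>: "0 < \<gamma> + 2"
    and \<sigma>0: "n < 2 * (\<gamma> + 2 * p) / (p - 1)"
    and alg: "\<And>A B L h q. 0 \<le> A \<Longrightarrow> 0 \<le> B \<Longrightarrow> \<bar>L + B\<bar> \<le> e * (A + B) \<Longrightarrow>
      (L + (\<gamma> / 2 - t) * A)\<^sup>2 / n \<le> h + 2 * (\<gamma> / 2 - t) * q + (\<gamma> / 2 - t)\<^sup>2 * A\<^sup>2 \<Longrightarrow>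
      L\<^sup>2 - h - \<gamma> * q + \<gamma> * A * L + t * (2 * q + (\<gamma> - 1) * A\<^sup>2 + A * L)
        + \<mu> * ((\<gamma> + p) * A * B + B * L) \<le> - c * (A + B)\<^sup>2"
    by (rule gidas_spruck_exponents[OF n3 p(1) p2], rule that)
  define \<sigma> where "\<sigma> = 2 * (\<gamma> + 2 * p) / (p - 1)"
  define s where "s = \<gamma> + 2 * p"
  have s: "0 < s" using \<gamma> p by (simp add: s_def)
  have \<sigma>: "n < \<sigma>" using \<sigma>0 by (simp add: \<sigma>_def)
  \<comment> \<open>With N = m + 2 \<ge> \<sigma> the product of \<phi> = \<zeta>^N and
    (k\<zeta>)^(-\<sigma>) stays below k^(-\<sigma>). Also m \<ge> 1, so the second derivatives of
    \<phi> vanish on the sphere of radius k.\<close>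
  define m where "m = nat \<lceil>\<sigma>\<rceil> + 1"
  define N where "N = real (m + 2)"
  have N0: "0 < N" and N\<sigma>: "\<sigma> \<le> N" by (auto simp: N_def m_def) linarith
  \<comment> \<open>\<open>C1\<close> collects the terms containing grad \<phi>, of size
    2N\<zeta>^(m+1)/k, and \<open>C2\<close> bounds the Laplacian of \<phi>. The summand
    \<open>C1\<^sup>2 / c\<close> of \<open>C4\<close> is the price of completing the
    square.\<close>
  define C1 where "C1 = 2 * N * (2 + \<bar>t + \<gamma> / 2\<bar> + \<bar>\<mu>\<bar>)"
  define C2 where "C2 = 2 * N * n + 4 * N * N"
  define C4 where "C4 = C1\<^sup>2 / c + C2"
  have C1: "0 < C1" and C2: "0 < C2" using N0 n3 by (auto simp: C1_def C2_def intro!: mult_pos_pos add_pos_nonneg)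
  have C4: "0 < C4" using C1 C2 c by (auto simp: C4_def intro!: add_pos_pos)
  have cC: "0 < c / (4 * C4)" using c C4 by simp
  obtain D where D: "0 < D" and absorb0: "\<And>u S z. 0 < u \<Longrightarrow> u powr p \<le> S \<Longrightarrow> 0 < z \<Longrightarrow>
    u powr \<gamma> * (S * u / z\<^sup>2) \<le> c / (4 * C4) * (u powr \<gamma> * S\<^sup>2) + D * z powr (- (2 * (\<gamma> + 2 * p) / (p - 1)))"
    by (rule powr_absorption[OF p(1) \<gamma> cC], rule that)
  note absorb = absorb0[folded \<sigma>_def]
  define V where "V = unit_ball_vol n"
  have V: "0 < V" using n3 by (simp add: V_def)
  \<comment> \<open>The power of 4/3 inverts the lower bound of \<phi> on the ball of radius k/2,
    where \<zeta> \<ge> 3/4.\<close>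
  define C where "C = 2 * C4 * D * (4 / 3) ^ (m + 2) / c"
  have C0: "0 < C" using C4 D c by (simp add: C_def)
  show ?thesis
  proof (rule that[OF e(1) s _ C0])
    show "real CARD('n) < \<sigma>" using \<sigma> by (simp add: n_def)
    fix M k K y \<rho> \<kappa> and u :: "real^'n \<Rightarrow> real" and G H
    assume M: "\<bar>M\<bar> \<le> e" and k: "0 < k" "k < K"
      and sol: "solution_ball K u G H p (2 * p / (p + 1)) M"
      and sub: "ball y \<rho> \<subseteq> ball 0 (k / 2)" and \<rho>: "0 < \<rho>" and \<kappa>: "0 < \<kappa>"
      and lower: "\<And>x. x \<in> ball y \<rho> \<Longrightarrow> \<kappa> \<le> u x"
    interpret solution_ball K u G H p "2 * p / (p + 1)" M by (rule sol)
    define \<zeta> where "\<zeta> x = max 0 (1 - (x \<bullet> x) / k\<^sup>2)" for x :: "real^'n"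
    define \<phi> where "\<phi> x = \<zeta> x ^ Suc (Suc m)" for x
    define d\<phi> where "d\<phi> i x = - (2 * N / k\<^sup>2) * (x $ i * \<zeta> x ^ Suc m)" for i x
    define dd\<phi> where "dd\<phi> i x = - (2 * N / k\<^sup>2) * (\<zeta> x ^ Suc m
       + x $ i * (- (2 * (N - 1) / k\<^sup>2) * (x $ i * \<zeta> x ^ m)))" for i x
    have \<zeta>0: "\<zeta> x = 0" if "k \<le> norm x" for x
    proof -
      have "k\<^sup>2 \<le> (norm x)\<^sup>2" using that k by (intro power_mono) auto
      then have "1 \<le> (x \<bullet> x) / k\<^sup>2" using k by (simp add: power2_norm_eq_inner)
      then show ?thesis by (simp add: \<zeta>_def)
    qed
    have \<zeta>pos: "0 < \<zeta> x" if "norm x < k" for x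
    proof -
      have "(norm x)\<^sup>2 < k\<^sup>2" using that k by (intro power_strict_mono) auto
      then have "(x \<bullet> x) / k\<^sup>2 < 1" using k by (simp add: power2_norm_eq_inner)
      then show ?thesis by (simp add: \<zeta>_def)
    qed
    have \<zeta>1: "\<zeta> x \<le> 1" and \<zeta>nn: "0 \<le> \<zeta> x" for x by (auto simp: \<zeta>_def)
    have \<phi>nn: "0 \<le> \<phi> x" for x by (simp add: \<phi>_def \<zeta>nn)
    have m1: "m = Suc (m - 1)" by (simp add: m_def)
    have \<zeta>cont: "continuous_on UNIV (\<lambda>x. \<zeta> x ^ j)" for j
      unfolding \<zeta>_def by (rule continuous_cutoff_base)
    interpret cutoff_ball K u G H k \<phi> d\<phi> dd\<phi>
    proof unfold_locales
      show "continuous_on UNIV \<phi>" unfolding \<phi>_def by (rule \<zeta>cont)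
      show "continuous_on UNIV (d\<phi> i)" for i unfolding d\<phi>_def by (intro continuous_intros \<zeta>cont)
      show "continuous_on UNIV (dd\<phi> i)" for i unfolding dd\<phi>_def by (intro continuous_intros \<zeta>cont)
      show "has_pderiv i \<phi> (d\<phi> i x) x" for i x
        using has_pderiv_cutoff_power[of i k m x] by (simp add: \<phi>_def[abs_def] d\<phi>_def \<zeta>_def N_def)
      show "has_pderiv i (d\<phi> i) (dd\<phi> i x) x" for i x
      proof -
        have "has_pderiv i (\<lambda>x. \<zeta> x ^ Suc m) (- (2 * (N - 1) / k\<^sup>2) * (x $ i * \<zeta> x ^ m)) x"
          using has_pderiv_cutoff_power[of i k "m - 1" x] m1
          by (simp add: \<zeta>_def N_def algebra_simps del: power_Suc)
        from has_pderiv_cmult[OF has_pderiv_mult[OF has_pderiv_component[of i i x] this], of "- (2 * N / k\<^sup>2)"]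
        show ?thesis unfolding d\<phi>_def by (rule has_pderiv_cong_value) (simp add: dd\<phi>_def algebra_simps)
      qed
      show "dd\<phi> i x = 0" if "k \<le> norm x" for i x
        using \<zeta>0[OF that] m1 by (simp add: dd\<phi>_def power_0_left)
    qed (use k \<zeta>0 in \<open>auto simp: \<phi>_def d\<phi>_def\<close>)
    define Z where "Z x = u x powr \<gamma> * (\<phi> x * (
      (lap x)\<^sup>2 - hess2 x - \<gamma> * (hess_grad x / u x) + \<gamma> * (grad2 x / u x) * lap x
      + t * (2 * (hess_grad x / u x) + (\<gamma> - 1) * (grad2 x / u x)\<^sup>2 + grad2 x / u x * lap x)
      + \<mu> * ((\<gamma> + p) * (grad2 x / u x) * u x powr p + u x powr p * lap x))
    + radial x * lap x + (t + \<gamma> / 2) * (grad2 x / u x) * radial x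
    + grad2 x * lap_phi x / 2 + \<mu> * u x powr p * radial x)" for x
    have Z: "has_bochner_integral lborel Z 0"
      unfolding Z_def by (rule integral_combined)
    \<comment> \<open>As \<open>Z\<close> integrates to 0, this is the integral estimate before
      integration.\<close>
    have pointwise: "c / 2 * (\<phi> x * u x powr s) \<le> C4 * D * k powr (- \<sigma>) * indicator (ball 0 k) x - Z x" for x
    proof (cases "norm x < k")
      case False
      then have "Z x = 0" "\<phi> x = 0"
        using phi_outside[of x] by (auto simp: Z_def radial_def lap_phi_def)
      then show ?thesis using C4 D by simp
    next
      case True
      then have xK: "x \<in> ball 0 K" using k by simp
      \<comment> \<open>Comparable to the distance of \<open>x\<close> from the sphere of radius
        \<open>k\<close>: between that distance and twice it.\<close>
      define z where "z = k * \<zeta> x"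
      have z: "0 < z" "0 < \<zeta> x" using \<zeta>pos[OF True] k by (auto simp: z_def)
      have u: "0 < u x" by (rule u_pos[OF xK])
      define g where "g = norm (G x)"
      have g: "0 \<le> g" "grad2 x = g\<^sup>2" by (auto simp: g_def grad2_eq)
      define A where "A = grad2 x / u x"
      define B where "B = u x powr p"
      define S where "S = A + B"
      have AB: "0 \<le> A" "0 < B" using u g by (auto simp: A_def B_def)
      have S: "0 < S" using AB by (simp add: S_def)
      have gS: "g\<^sup>2 \<le> S * u x" using AB u g by (simp add: S_def A_def field_simps)
      have "g powr (2 * p / (p + 1)) \<le> S"
        using gradient_term_bound[OF p(1) u g(1)] by (simp add: S_def A_def B_def g)
      then have "\<bar>M\<bar> * g powr (2 * p / (p + 1)) \<le> e * S"
        using M S e by (intro mult_mono) auto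
      moreover have "lap x + B = - (M * g powr (2 * p / (p + 1)))"
        using equation[OF xK] by (simp add: B_def g_def)
      \<comment> \<open>The equation in the form that \<open>alg\<close> expects: the gradient term
        moves lap u + u^p by at most e(A + B).\<close>
      ultimately have lapB: "\<bar>lap x + B\<bar> \<le> e * S" by (simp add: abs_mult)
      also have "\<dots> \<le> 1 * S" using e S by (intro mult_right_mono) auto
      finally have lap2: "\<bar>lap x\<bar> \<le> 2 * S" using AB by (simp add: S_def)
      have radial: "\<bar>radial x\<bar> \<le> 2 * N / k * (\<zeta> x ^ Suc m * g)"
      proof -
        have "radial x = - (2 * N / k\<^sup>2) * \<zeta> x ^ Suc m * (x \<bullet> G x)"
          unfolding radial_def d\<phi>_def inner_vec_def sum_distrib_left
          by (intro sum.cong refl) (simp add: mult_ac)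
        then have "\<bar>radial x\<bar> = 2 * N / k\<^sup>2 * \<zeta> x ^ Suc m * \<bar>x \<bullet> G x\<bar>"
          using N0 z by (simp add: abs_mult)
        also have "\<dots> \<le> 2 * N / k\<^sup>2 * \<zeta> x ^ Suc m * (k * g)"
          using N0 z True Cauchy_Schwarz_ineq2[of x "G x"] mult_right_mono[of "norm x" k "norm (G x)"]
          by (intro mult_left_mono) (auto simp: g_def)
        also have "\<dots> = 2 * N / k * (\<zeta> x ^ Suc m * g)"
          using k by (simp add: power2_eq_square)
        finally show ?thesis .
      qed
      have lap_phi: "\<bar>lap_phi x\<bar> \<le> C2 / k\<^sup>2 * \<zeta> x ^ m"
      proof -
        have "lap_phi x = - (2 * N / k\<^sup>2) * (n * \<zeta> x ^ Suc m - 2 * (N - 1) / k\<^sup>2 * \<zeta> x ^ m * (x \<bullet> x))"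
        proof -
          have "lap_phi x = (\<Sum>i\<in>UNIV. - (2 * N / k\<^sup>2) * \<zeta> x ^ Suc m
              + 2 * N / k\<^sup>2 * (2 * (N - 1) / k\<^sup>2 * \<zeta> x ^ m) * (x $ i * x $ i))"
            unfolding lap_phi_def dd\<phi>_def by (intro sum.cong refl) (simp only: ring_distribs, simp)
          also have "\<dots> = n * (- (2 * N / k\<^sup>2) * \<zeta> x ^ Suc m)
              + 2 * N / k\<^sup>2 * (2 * (N - 1) / k\<^sup>2 * \<zeta> x ^ m) * (x \<bullet> x)"
            by (simp only: sum.distrib sum_distrib_left[symmetric] inner_vec_def inner_real_def sum_constant n_def)
              (simp add: mult_ac)
          finally show ?thesis by (simp add: algebra_simps add_divide_distrib diff_divide_distrib)
        qed
        then have "\<bar>lap_phi x\<bar> = 2 * N / k\<^sup>2 * \<bar>n * \<zeta> x ^ Suc m - 2 * (N - 1) / k\<^sup>2 * \<zeta> x ^ m * (x \<bullet> x)\<bar>"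
          using N0 by (simp add: abs_mult)
        also have "\<dots> \<le> 2 * N / k\<^sup>2 * (n * \<zeta> x ^ m + 2 * N * \<zeta> x ^ m)"
        proof (intro mult_left_mono)
          have "n * (\<zeta> x * \<zeta> x ^ m) \<le> n * (1 * \<zeta> x ^ m)"
            using n3 \<zeta>1 \<zeta>nn by (intro mult_left_mono mult_right_mono) auto
          moreover have "0 \<le> n * \<zeta> x ^ Suc m" using n3 \<zeta>nn by simp
          moreover have "(x \<bullet> x) / k\<^sup>2 \<le> 1" using z by (simp add: \<zeta>_def split: if_splits)
          then have "2 * (N - 1) * \<zeta> x ^ m * ((x \<bullet> x) / k\<^sup>2) \<le> 2 * N * \<zeta> x ^ m * 1"
            using \<zeta>nn N0 by (intro mult_mono) (auto simp: N_def)
          moreover have "0 \<le> 2 * (N - 1) * \<zeta> x ^ m * ((x \<bullet> x) / k\<^sup>2)"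
            using \<zeta>nn by (auto simp: N_def)
          ultimately show "\<bar>n * \<zeta> x ^ Suc m - 2 * (N - 1) / k\<^sup>2 * \<zeta> x ^ m * (x \<bullet> x)\<bar> \<le> n * \<zeta> x ^ m + 2 * N * \<zeta> x ^ m"
            by simp
        qed (use N0 in auto)
        also have "\<dots> = C2 / k\<^sup>2 * \<zeta> x ^ m" by (simp add: C2_def algebra_simps add_divide_distrib)
        finally show ?thesis .
      qed
      have cut: "radial x * lap x + (t + \<gamma> / 2) * A * radial x + g\<^sup>2 * lap_phi x / 2 + \<mu> * B * radial x
        \<le> \<phi> x * (c / 4 * S\<^sup>2 + C4 * (S * u x / z\<^sup>2))"
      proof -
        have c1: "radial x * lap x \<le> \<bar>radial x\<bar> * (2 * S)"
          using mult_mono[OF order_refl lap2, of "\<bar>radial x\<bar>"] abs_ge_self[of "radial x * lap x"]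
          by (simp add: abs_mult)
        have c2: "(t + \<gamma> / 2) * A * radial x \<le> \<bar>radial x\<bar> * (\<bar>t + \<gamma> / 2\<bar> * S)"
        proof -
          have "\<bar>(t + \<gamma> / 2) * A * radial x\<bar> = \<bar>radial x\<bar> * (\<bar>t + \<gamma> / 2\<bar> * A)" using AB by (simp add: abs_mult)
          also have "\<dots> \<le> \<bar>radial x\<bar> * (\<bar>t + \<gamma> / 2\<bar> * S)"
            using AB by (intro mult_left_mono) (auto simp: S_def)
          finally show ?thesis by linarith
        qed
        have c3: "\<mu> * B * radial x \<le> \<bar>radial x\<bar> * (\<bar>\<mu>\<bar> * S)"
        proof -
          have "\<bar>\<mu> * B * radial x\<bar> = \<bar>radial x\<bar> * (\<bar>\<mu>\<bar> * B)" using AB by (simp add: abs_mult)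
          also have "\<dots> \<le> \<bar>radial x\<bar> * (\<bar>\<mu>\<bar> * S)"
            using AB by (intro mult_left_mono) (auto simp: S_def)
          finally show ?thesis by linarith
        qed
        have c4: "g\<^sup>2 * lap_phi x / 2 \<le> g\<^sup>2 * (C2 / k\<^sup>2 * \<zeta> x ^ m)"
        proof -
          have half: "y \<le> w \<Longrightarrow> 0 \<le> w \<Longrightarrow> y / 2 \<le> w" for y w :: real by simp
          show ?thesis
            using lap_phi C2 \<zeta>nn by (intro half mult_left_mono mult_nonneg_nonneg) auto
        qed
        have "radial x * lap x + (t + \<gamma> / 2) * A * radial x + g\<^sup>2 * lap_phi x / 2 + \<mu> * B * radial x
          \<le> \<bar>radial x\<bar> * (2 * S) + \<bar>radial x\<bar> * (\<bar>t + \<gamma> / 2\<bar> * S) + g\<^sup>2 * (C2 / k\<^sup>2 * \<zeta> x ^ m)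
            + \<bar>radial x\<bar> * (\<bar>\<mu>\<bar> * S)"
          by (intro add_mono c1 c2 c3 c4)
        also have "\<dots> = \<bar>radial x\<bar> * ((2 + \<bar>t + \<gamma> / 2\<bar> + \<bar>\<mu>\<bar>) * S) + g\<^sup>2 * (C2 / k\<^sup>2 * \<zeta> x ^ m)"
          by (simp add: algebra_simps)
        also have "\<dots> \<le> \<phi> x * (c / 4 * S\<^sup>2 + C1\<^sup>2 / c * (g\<^sup>2 / z\<^sup>2)) + \<phi> x * (C2 * (g\<^sup>2 / z\<^sup>2))"
        proof (rule add_mono)
          have "\<bar>radial x\<bar> * ((2 + \<bar>t + \<gamma> / 2\<bar> + \<bar>\<mu>\<bar>) * S) \<le>
             2 * N / k * (\<zeta> x ^ Suc m * g) * ((2 + \<bar>t + \<gamma> / 2\<bar> + \<bar>\<mu>\<bar>) * S)"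
            using radial S by (intro mult_right_mono) auto
          also have "\<dots> = \<phi> x * (C1 * (S * g) / z)"
            using z k by (simp add: \<phi>_def C1_def z_def)
          also have "\<dots> \<le> \<phi> x * (c / 4 * S\<^sup>2 + C1\<^sup>2 / c * (g\<^sup>2 / z\<^sup>2))"
          proof (rule mult_left_mono)
            \<comment> \<open>The square is chosen so that its S^2 term is c/4, small enough to be
              paid from the -c of \<open>main\<close>.\<close>
            have "0 \<le> (c * S / 2 - C1 * (g / z))\<^sup>2 / c" using c by simp
            also have "(c * S / 2 - C1 * (g / z))\<^sup>2 / c = c / 4 * S\<^sup>2 - C1 * (S * g) / z + C1\<^sup>2 / c * (g\<^sup>2 / z\<^sup>2)"
              using c z by (simp add: field_simps power2_eq_square)
            finally show "C1 * (S * g) / z \<le> c / 4 * S\<^sup>2 + C1\<^sup>2 / c * (g\<^sup>2 / z\<^sup>2)" by simp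
          qed (rule \<phi>nn)
          finally show "\<bar>radial x\<bar> * ((2 + \<bar>t + \<gamma> / 2\<bar> + \<bar>\<mu>\<bar>) * S)
            \<le> \<phi> x * (c / 4 * S\<^sup>2 + C1\<^sup>2 / c * (g\<^sup>2 / z\<^sup>2))" .
          show "g\<^sup>2 * (C2 / k\<^sup>2 * \<zeta> x ^ m) \<le> \<phi> x * (C2 * (g\<^sup>2 / z\<^sup>2))"
            using z k by (simp add: \<phi>_def z_def power_mult_distrib power2_eq_square mult_ac)
        qed
        also have "\<dots> = \<phi> x * (c / 4 * S\<^sup>2 + C4 * (g\<^sup>2 / z\<^sup>2))"
          by (simp add: C4_def algebra_simps add_divide_distrib)
        also have "\<dots> \<le> \<phi> x * (c / 4 * S\<^sup>2 + C4 * (S * u x / z\<^sup>2))"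
          using gS C4 \<zeta>nn by (intro mult_left_mono add_left_mono divide_right_mono) (auto simp: \<phi>_def)
        finally show ?thesis .
      qed
      have main: "(lap x)\<^sup>2 - hess2 x - \<gamma> * (hess_grad x / u x) + \<gamma> * A * lap x
      + t * (2 * (hess_grad x / u x) + (\<gamma> - 1) * A\<^sup>2 + A * lap x)
      + \<mu> * ((\<gamma> + p) * A * B + B * lap x) \<le> - c * S\<^sup>2"
        unfolding S_def using AB lapB hessian_trace_inequality[of x "\<gamma> / 2 - t"]
        by (intro alg) (auto simp: S_def A_def n_def)
      have "Z x \<le> u x powr \<gamma> * (\<phi> x * (- c * S\<^sup>2) + \<phi> x * (c / 4 * S\<^sup>2 + C4 * (S * u x / z\<^sup>2)))"
        unfolding Z_def A_def[symmetric] B_def[symmetric]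
        using mult_left_mono[OF main, of "\<phi> x"] cut \<zeta>nn
        by (intro mult_left_mono) (auto simp: \<phi>_def g)
      also have "\<dots> = \<phi> x * (- (3 / 4) * c * (u x powr \<gamma> * S\<^sup>2) + C4 * (u x powr \<gamma> * (S * u x / z\<^sup>2)))"
        by (simp add: algebra_simps)
      \<comment> \<open>The budget for S^2 is -c from \<open>main\<close>, c/4 from the cutoff terms
        and c/4 from the absorption, which leaves -c/2.\<close>
      also have "\<dots> \<le> \<phi> x * (- (3 / 4) * c * (u x powr \<gamma> * S\<^sup>2)
          + C4 * (c / (4 * C4) * (u x powr \<gamma> * S\<^sup>2) + D * z powr (- \<sigma>)))"
        using absorb[OF u _ z(1), of S] AB C4 \<zeta>nn
        by (intro mult_left_mono add_left_mono) (auto simp: \<phi>_def S_def B_def)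
      also have "\<dots> = - (c / 2) * (\<phi> x * (u x powr \<gamma> * S\<^sup>2)) + C4 * D * (\<phi> x * z powr (- \<sigma>))"
        using C4 by (simp add: algebra_simps)
      also have "\<phi> x * z powr (- \<sigma>) \<le> k powr (- \<sigma>)"
      proof -
        have "\<phi> x = \<zeta> x powr N" unfolding \<phi>_def N_def powr_realpow[OF z(2)] by simp
        then have "\<phi> x * z powr (- \<sigma>) = k powr (- \<sigma>) * (\<zeta> x powr N * \<zeta> x powr (- \<sigma>))"
          unfolding z_def powr_mult by (simp only: mult_ac)
        moreover have "\<zeta> x powr N * \<zeta> x powr (- \<sigma>) = \<zeta> x powr (N - \<sigma>)"
          by (simp add: powr_add[symmetric])
        moreover have "\<zeta> x powr (N - \<sigma>) \<le> 1" using z \<zeta>1 N\<sigma> by (intro powr_le1) auto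
        ultimately show ?thesis
          using mult_left_mono[of "\<zeta> x powr (N - \<sigma>)" 1 "k powr (- \<sigma>)"] by simp
      qed
      also have "u x powr s \<le> u x powr \<gamma> * S\<^sup>2"
      proof -
        have "u x powr s = u x powr \<gamma> * B\<^sup>2"
          unfolding s_def B_def mult_2 powr_add power2_eq_square by (rule refl)
        also have "\<dots> \<le> u x powr \<gamma> * S\<^sup>2"
          using AB by (intro mult_left_mono power_mono) (auto simp: S_def)
        finally show ?thesis .
      qed
      then have "- (c / 2) * (\<phi> x * (u x powr \<gamma> * S\<^sup>2)) \<le> - (c / 2) * (\<phi> x * u x powr s)"
        using c \<zeta>nn by (auto simp: \<phi>_def intro!: mult_left_mono)
      finally have "Z x \<le> - (c / 2) * (\<phi> x * u x powr s) + C4 * D * k powr (- \<sigma>)"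
        using C4 D by auto
      then show ?thesis using True by simp
    qed
    have int1: "integrable lborel (\<lambda>x. c / 2 * (3 / 4) ^ (m + 2) * \<kappa> powr s * indicator (ball y \<rho>) x)"
      by (intro integrable_mult_right integrable_real_indicator emeasure_bounded_finite) auto
    have int2: "integrable lborel (\<lambda>x::real^'n. C4 * D * k powr (- \<sigma>) * indicator (ball 0 k) x)"
      by (intro integrable_mult_right integrable_real_indicator emeasure_bounded_finite) auto
    have "c / 2 * (3 / 4) ^ (m + 2) * \<kappa> powr s * measure lborel (ball y \<rho>)
      = (\<integral>x. c / 2 * (3 / 4) ^ (m + 2) * \<kappa> powr s * indicator (ball y \<rho>) x \<partial>lborel)"
      by simp
    also have "\<dots> \<le> (\<integral>x. C4 * D * k powr (- \<sigma>) * indicator (ball 0 k) x - Z x \<partial>lborel)"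
    proof (rule integral_mono[OF int1])
      show "integrable lborel (\<lambda>x. C4 * D * k powr (- \<sigma>) * indicator (ball 0 k) x - Z x)"
        using Z by (intro Bochner_Integration.integrable_diff int2) (auto simp: has_bochner_integral_iff)
      fix x :: "real^'n"
      have "c / 2 * (3 / 4) ^ (m + 2) * \<kappa> powr s * indicator (ball y \<rho>) x \<le> c / 2 * (\<phi> x * u x powr s)"
      proof (cases "x \<in> ball y \<rho>")
        case True
        have "norm x < k / 2" using sub True by (auto simp: mem_ball_0[symmetric])
        then have "(norm x)\<^sup>2 \<le> (k / 2)\<^sup>2" by (intro power_mono) auto
        then have "(x \<bullet> x) / k\<^sup>2 \<le> 1 / 4"
          using k by (simp add: power2_norm_eq_inner field_simps)
        then have "3 / 4 \<le> 1 - (x \<bullet> x) / k\<^sup>2" by linarith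
        also have "\<dots> \<le> \<zeta> x" by (simp add: \<zeta>_def)
        finally have "3 / 4 \<le> \<zeta> x" .
        then have "(3 / 4) ^ (m + 2) \<le> \<phi> x" unfolding \<phi>_def by (simp only: add_2_eq_Suc') (rule power_mono, auto)
        moreover have "\<kappa> powr s \<le> u x powr s" using lower[OF True] \<kappa> s by (intro powr_mono2) auto
        ultimately have "(3 / 4) ^ (m + 2) * \<kappa> powr s \<le> \<phi> x * u x powr s"
          using \<zeta>nn by (intro mult_mono) (auto simp: \<phi>_def)
        then have "c / 2 * ((3 / 4) ^ (m + 2) * \<kappa> powr s) \<le> c / 2 * (\<phi> x * u x powr s)"
          using c by (intro mult_left_mono) auto
        then show ?thesis using True by (simp only: mult.assoc indicator_simps mult_1_right)
      qed (use c \<zeta>nn in \<open>auto simp: \<phi>_def\<close>)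
      also note pointwise
      finally show "c / 2 * (3 / 4) ^ (m + 2) * \<kappa> powr s * indicator (ball y \<rho>) x
        \<le> C4 * D * k powr (- \<sigma>) * indicator (ball 0 k) x - Z x" .
    qed
    also have "\<dots> = (\<integral>x. C4 * D * k powr (- \<sigma>) * indicator (ball (0::real^'n) k) x \<partial>lborel) - (\<integral>x. Z x \<partial>lborel)"
      using Z by (intro Bochner_Integration.integral_diff int2) (auto simp: has_bochner_integral_iff)
    also have "\<dots> = C4 * D * k powr (- \<sigma>) * measure lborel (ball (0::real^'n) k)"
      using Z by (simp add: has_bochner_integral_iff)
    finally have "c / 2 * (3 / 4) ^ (m + 2) * \<kappa> powr s * (V * \<rho> ^ CARD('n))
      \<le> C4 * D * k powr (- \<sigma>) * (V * k ^ CARD('n))"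
      using \<rho> k by (simp add: content_ball V_def n_def)
    then have "V * (c / 2 * (3 / 4) ^ (m + 2) * \<kappa> powr s * \<rho> ^ CARD('n))
      \<le> V * (C4 * D * (k powr (- \<sigma>) * k ^ CARD('n)))"
      by (simp add: mult_ac)
    then have "c / 2 * (3 / 4) ^ (m + 2) * (\<kappa> powr s * \<rho> ^ CARD('n))
      \<le> C4 * D * (k powr (- \<sigma>) * k ^ CARD('n))"
      using V by (simp add: mult_ac)
    also have "k powr (- \<sigma>) * k ^ CARD('n) = k powr (real CARD('n) - \<sigma>)"
      using k by (simp add: powr_realpow[symmetric] powr_add[symmetric])
    finally show "\<kappa> powr s * \<rho> ^ CARD('n) \<le> C * k powr (real CARD('n) - \<sigma>)"
      using c by (simp add: C_def field_simps)
  qed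
qed

section \<open>An interior gradient bound\<close>

lemma second_derivative_at_local_min:
  fixes f f' :: "real \<Rightarrow> real"
  assumes "0 < d" "\<And>s. \<bar>s\<bar> < d \<Longrightarrow> (f has_real_derivative f' s) (at s)"
    "(f' has_real_derivative f'') (at 0)" "\<And>s. \<bar>s\<bar> < d \<Longrightarrow> f 0 \<le> f s"
  shows "0 \<le> f''"
proof (rule ccontr)
  assume "\<not> 0 \<le> f''"
  then obtain e where e: "0 < e" "\<And>h. 0 < h \<Longrightarrow> h < e \<Longrightarrow> f' h < f' 0"
    using DERIV_neg_dec_right[OF assms(3)] by auto
  have "f' 0 = 0"
    using assms by (intro DERIV_local_min[of f "f' 0" 0 d]) auto
  define h where "h = min d e / 2"
  have h: "0 < h" "h < d" "h < e" using assms(1) e(1) by (auto simp: h_def)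
  obtain z where "0 < z" "z < h" "f h - f 0 = (h - 0) * f' z"
    using MVT2[of 0 h f f'] assms(2) h by auto
  moreover from this have "f' z < 0" using e(2)[of z] h \<open>f' 0 = 0\<close> by auto
  ultimately have "f h < f 0" using h by (simp add: mult_pos_neg less_diff_eq algebra_simps)
  then show False using assms(4)[of h] h by auto
qed

lemma second_pderiv_at_local_min:
  fixes v :: "real^'n::finite \<Rightarrow> real"
  assumes "open S" "z \<in> S" "\<And>x. x \<in> S \<Longrightarrow> has_pderiv i v (dv x) x"
    "has_pderiv i dv ddv z" "\<And>x. x \<in> S \<Longrightarrow> v z \<le> v x"
  shows "0 \<le> ddv"
proof -
  obtain d where d: "0 < d" "ball z d \<subseteq> S" using assms(1,2) openE by blast
  show ?thesis
  proof (rule second_derivative_at_local_min[of d "\<lambda>t. v (z + t *\<^sub>R axis i 1)" "\<lambda>t. dv (z + t *\<^sub>R axis i 1)"])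
    show "((\<lambda>t. dv (z + t *\<^sub>R axis i 1)) has_real_derivative ddv) (at 0)"
      using assms(4) by (simp add: has_pderiv_def)
    fix s :: real assume "\<bar>s\<bar> < d"
    then have "z + s *\<^sub>R axis i 1 \<in> S" using d(2) by (auto simp: dist_norm)
    then show "((\<lambda>t. v (z + t *\<^sub>R axis i 1)) has_real_derivative dv (z + s *\<^sub>R axis i 1)) (at s)"
      "v (z + 0 *\<^sub>R axis i 1) \<le> v (z + s *\<^sub>R axis i 1)"
      using assms(3,5) by (auto intro!: has_pderiv_along_line)
  qed (rule d(1))
qed

definition reflect :: "'n::finite \<Rightarrow> real^'n \<Rightarrow> real^'n" where
  "reflect i x = x - (2 * x $ i) *\<^sub>R axis i 1"

lemma norm_reflect: "norm (reflect i x) = norm x"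
proof -
  have "reflect i x \<bullet> reflect i x = x \<bullet> x"
    by (simp add: reflect_def inner_diff_left inner_diff_right inner_axis inner_axis' algebra_simps)
  then show ?thesis by (simp add: norm_eq)
qed

lemma reflect_shift:
  "reflect i (x + t *\<^sub>R axis j 1) = reflect i x + (if i = j then - t else t) *\<^sub>R axis j 1"
  by (auto simp: reflect_def axis_def vec_eq_iff algebra_simps)

lemma has_pderiv_reflect:
  assumes "has_pderiv j f d (reflect i x)"
  shows "has_pderiv j (\<lambda>x. f (reflect i x)) (if i = j then - d else d) x"
proof (cases "i = j")
  case True
  have "((\<lambda>t. f (reflect i x + t *\<^sub>R axis j 1)) has_real_derivative d) (at (- 0))"
    using assms by (simp add: has_pderiv_def)
  then have "((\<lambda>t. f (reflect i x + (- t) *\<^sub>R axis j 1)) has_real_derivative - d) (at 0)"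
    by (rule DERIV_mirror[THEN iffD1])
  then show ?thesis using True by (simp add: has_pderiv_def reflect_shift)
qed (use assms in \<open>simp add: has_pderiv_def reflect_shift\<close>)

lemma continuous_on_reflect: "continuous_on S (reflect i)"
  unfolding reflect_def by (intro continuous_intros)

text \<open>Comparison on the half ball \<open>x\<^sub>i > 0\<close>: the odd part of \<open>u\<close> in \<open>x\<^sub>i\<close> vanishes for
  \<open>x\<^sub>i = 0\<close> and is dominated by a quadratic barrier that grows linearly in \<open>x\<^sub>i\<close>.\<close>

lemma (in positive_C2_ball) pderiv_bound:
  assumes r: "0 < r" "r < K"
    and U: "\<And>x. norm x \<le> r \<Longrightarrow> u x \<le> U"
    and Q: "\<And>x. norm x \<le> r \<Longrightarrow> \<bar>lap x\<bar> \<le> Q"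
    and \<sigma>: "\<sigma> = 1 \<or> \<sigma> = -1"
  shows "2 * (\<sigma> * G 0 $ i) \<le> real CARD('n) * U / r + Q * r"
proof (rule field_le_epsilon)
  fix e :: real assume e: "0 < e"
  define n where "n = real CARD('n)"
  \<comment> \<open>Chosen so that the Laplacian of \<open>v\<close> is at most -2e/r inside the
    half ball. The positive \<open>e\<close> makes this strict and is let go to 0 by
    \<open>field_le_epsilon\<close>.\<close>
  define a where "a = n * U / r\<^sup>2 + Q + e / r"
  define w where "w x = \<sigma> * (u x - u (reflect i x))" for x
  define v where "v x = U / r\<^sup>2 * (x \<bullet> x) + a * (x $ i * (r - x $ i)) - w x" for x
  define dv where "dv j x = U / r\<^sup>2 * (2 * x $ j) + a * (if j = i then r - 2 * x $ i else 0)
     - \<sigma> * (G x $ j - (if i = j then - G (reflect i x) $ j else G (reflect i x) $ j))" for j x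
  define ddv where "ddv j x = U / r\<^sup>2 * 2 + a * (if j = i then - 2 else 0)
     - \<sigma> * (H x $ j $ j - H (reflect i x) $ j $ j)" for j x
  have U0: "0 < U" using u_pos[of 0] U[of 0] r by auto
  have Q0: "0 \<le> Q" using Q[of 0] r by auto
  have a0: "0 < a" using U0 Q0 e r by (auto simp: a_def n_def intro!: add_nonneg_pos)
  have refl: "reflect i x \<in> ball 0 K" if "x \<in> ball 0 K" for x
    using that by (simp add: norm_reflect)
  have dv: "has_pderiv j v (dv j x) x" if x: "x \<in> ball 0 K" for j x
  proof -
    have "has_pderiv j (\<lambda>x. x \<bullet> x) (2 * x $ j) x"
    proof -
      have "((\<lambda>x. x \<bullet> x) has_derivative (\<lambda>h. x \<bullet> h + h \<bullet> x)) (at x)"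
        by (auto intro!: derivative_eq_intros)
      from has_pderiv_of_derivative[OF this, of j] show ?thesis by (simp add: inner_axis inner_axis')
    qed
    moreover have "has_pderiv j (\<lambda>x. x $ i * (r - x $ i)) (if j = i then r - 2 * x $ i else 0) x"
      unfolding has_pderiv_def by (auto intro!: derivative_eq_intros simp: axis_def)
    moreover have "has_pderiv j w (\<sigma> * (G x $ j - (if i = j then - G (reflect i x) $ j else G (reflect i x) $ j))) x"
      unfolding w_def by (intro has_pderiv_cmult has_pderiv_diff has_pderiv_reflect u_pderiv x refl)
    ultimately show ?thesis
      unfolding v_def dv_def by (intro has_pderiv_diff has_pderiv_add has_pderiv_cmult)
  qed
  have ddv: "has_pderiv j (dv j) (ddv j x) x" if x: "x \<in> ball 0 K" for j x
  proof -
    have "has_pderiv j (\<lambda>x. 2 * x $ j) 2 x"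
      unfolding has_pderiv_def by (auto intro!: derivative_eq_intros simp: axis_def)
    moreover have "has_pderiv j (\<lambda>x. if j = i then r - 2 * x $ i else 0) (if j = i then - 2 else 0) x"
      unfolding has_pderiv_def by (auto intro!: derivative_eq_intros simp: axis_def)
    moreover have "has_pderiv j (\<lambda>x. if i = j then - G (reflect i x) $ j else G (reflect i x) $ j) (H (reflect i x) $ j $ j) x"
    proof -
      have "has_pderiv j (\<lambda>x. (if i = j then -1 else 1) * G (reflect i x) $ j)
        ((if i = j then -1 else 1) * (if i = j then - H (reflect i x) $ j $ j else H (reflect i x) $ j $ j)) x"
        by (intro has_pderiv_cmult has_pderiv_reflect[where f = "\<lambda>x. G x $ j"] G_pderiv refl x)
      then show ?thesis by (cases "i = j") auto
    qed
    ultimately show ?thesis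
      unfolding dv_def ddv_def by (intro has_pderiv_diff has_pderiv_add has_pderiv_cmult G_pderiv x)
  qed
  define T where "T = cball 0 r \<inter> {x::real^'n. 0 \<le> x $ i}"
  have T: "compact T" "0 \<in> T"
    using r by (auto simp: T_def intro!: compact_Int_closed closed_halfspace_component_ge_cart)
  have TK: "T \<subseteq> ball 0 K" using r by (auto simp: T_def)
  have v_cont: "continuous_on T v"
  proof -
    have "continuous_on (ball 0 K) (\<lambda>x. u (reflect i x))"
      by (rule continuous_on_compose2[OF u_cont continuous_on_reflect]) (use refl in auto)
    then show ?thesis
      unfolding v_def w_def using continuous_on_subset[OF _ TK] u_cont
      by (intro continuous_intros) auto
  qed
  obtain z where z: "z \<in> T" and zmin: "\<And>x. x \<in> T \<Longrightarrow> v z \<le> v x"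
    using continuous_attains_inf[OF T(1) _ v_cont] T(2) by blast
  have wU: "w x \<le> U" if "norm x \<le> r" for x
    using \<sigma> U[of x] U[of "reflect i x"] u_pos[of x] u_pos[of "reflect i x"] that r
    by (auto simp: w_def norm_reflect)
  \<comment> \<open>On the flat side the odd part \<open>w\<close> is 0, on the sphere the barrier
    is at least \<open>U\<close>, which bounds \<open>w\<close> because \<open>u\<close> is
    positive, and an interior minimum would contradict the sign of the Laplacian.\<close>
  have "0 \<le> v z"
  proof -
    consider "z $ i = 0" | "norm z = r" "0 \<le> z $ i" | "norm z < r" "0 < z $ i"
      using z by (fastforce simp: T_def)
    then show ?thesis
    proof cases
      case 1
      then have "reflect i z = z" by (simp add: reflect_def)
      then show ?thesis using 1 U0 by (simp add: v_def w_def)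
    next
      case 2
      have "z $ i \<le> r" using 2 component_le_norm_cart[of z i] by simp
      then have "0 \<le> a * (z $ i * (r - z $ i))" using 2 a0 by simp
      moreover have "U / r\<^sup>2 * (z \<bullet> z) = U" using 2 r by (simp add: power2_norm_eq_inner[symmetric])
      ultimately show ?thesis using wU[of z] 2 by (simp add: v_def)
    next
      case 3
      define S where "S = ball 0 r \<inter> {x::real^'n. 0 < x $ i}"
      have S: "open S" "z \<in> S" "S \<subseteq> T"
        using 3 by (auto simp: S_def T_def intro!: open_Int open_halfspace_component_gt_cart)
      have zK: "z \<in> ball 0 K" using TK z by auto
      have "0 \<le> ddv j z" for j
        by (rule second_pderiv_at_local_min[OF S(1,2) dv ddv zmin]) (use S TK zK in auto)
      then have "0 \<le> (\<Sum>j\<in>UNIV. ddv j z)" by (intro sum_nonneg) auto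
      also have "\<dots> = n * (U / r\<^sup>2 * 2) - 2 * a - \<sigma> * (lap z - lap (reflect i z))"
        unfolding ddv_def lap_def by (simp add: sum_subtractf sum.distrib n_def
            flip: sum_distrib_left) 
      also have "\<dots> \<le> n * (U / r\<^sup>2 * 2) - 2 * a + 2 * Q"
        using \<sigma> Q[of z] Q[of "reflect i z"] 3 by (auto simp: norm_reflect)
      also have "\<dots> < 0" using e r by (simp add: a_def)
      finally show ?thesis by simp
    qed
  qed
  have "v 0 = 0" by (simp add: v_def w_def reflect_def)
  \<comment> \<open>Along the inward axis v \<ge> 0 = v 0, so the slope of \<open>v\<close> at 0,
    which is a r - 2 \<sigma> u_i(0), is nonnegative.\<close>
  have "0 \<le> dv i 0"
  proof (rule ccontr)
    assume "\<not> 0 \<le> dv i 0"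
    then obtain d where d: "0 < d" "\<And>h. 0 < h \<Longrightarrow> h < d \<Longrightarrow> v (h *\<^sub>R axis i 1) < v 0"
      using DERIV_neg_dec_right[of "\<lambda>t. v (0 + t *\<^sub>R axis i 1)" "dv i 0" 0] dv[of 0 i] r
      by (auto simp: has_pderiv_def)
    define h where "h = min d r / 2"
    have h: "0 < h" "h < d" "h < r" using d(1) r by (auto simp: h_def)
    then have "h *\<^sub>R axis i 1 \<in> T" by (simp add: T_def)
    then show False using zmin d(2)[of h] h \<open>0 \<le> v z\<close> \<open>v 0 = 0\<close> by fastforce
  qed
  then have "2 * (\<sigma> * G 0 $ i) \<le> a * r"
    by (simp add: dv_def reflect_def algebra_simps)
  also have "\<dots> = n * U / r + Q * r + e"
    using r by (simp add: a_def field_simps power2_eq_square)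
  finally show "2 * (\<sigma> * G 0 $ i) \<le> real CARD('n) * U / r + Q * r + e" by (simp add: n_def)
qed

text \<open>Used contrapositively: if the gradient at 0 is not small while the Laplacian is bounded,
  \<open>u\<close> cannot be uniformly small near 0.\<close>

lemma (in positive_C2_ball) gradient_bound:
  assumes r: "0 < r" "r < K"
    and U: "\<And>x. norm x \<le> r \<Longrightarrow> u x \<le> U"
    and Q: "\<And>x. norm x \<le> r \<Longrightarrow> \<bar>lap x\<bar> \<le> Q"
  shows "norm (G 0) \<le> real CARD('n) * (real CARD('n) * U / r + Q * r)"
proof -
  let ?b = "real CARD('n) * U / r + Q * r"
  have "\<bar>G 0 $ i\<bar> \<le> ?b" for i
    using pderiv_bound[OF r U Q, of 1 i] pderiv_bound[OF r U Q, of "-1" i] by simp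
  then have "(\<Sum>i\<in>UNIV. \<bar>G 0 $ i\<bar>) \<le> (\<Sum>i\<in>(UNIV::'n set). ?b)" by (intro sum_mono) auto
  then show ?thesis using norm_le_l1_cart[of "G 0"] by simp
qed

section \<open>Rescaling\<close>

definition scaling_weight :: "real \<Rightarrow> (real^'n::finite \<Rightarrow> real) \<Rightarrow> (real^'n \<Rightarrow> real^'n) \<Rightarrow> real^'n \<Rightarrow> real" where
  "scaling_weight p u G x = u x powr ((p - 1) / 2) + norm (G x) powr ((p - 1) / (p + 1))"

text \<open>The gradient is multiplied by a l = l^((p+1)/(p-1)), and q = 2p/(p+1) makes (a l)^q = a
  l^2 = a^p. All terms of the equation therefore scale alike and \<open>M\<close> is unchanged,
  which is why one bound on |M| serves every scale.\<close>

lemma solution_ball_rescale: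
  fixes u :: "real^'n::finite \<Rightarrow> real"
  assumes sol: "solution_ball K u G H p (2 * p / (p + 1)) M"
    and p: "1 < p" and l: "0 < l" and sub: "ball y (l * k) \<subseteq> ball 0 K"
    and a: "a = l powr (2 / (p - 1))"
  shows "solution_ball k (\<lambda>x. a * u (y + l *\<^sub>R x)) (\<lambda>x. (a * l) *\<^sub>R G (y + l *\<^sub>R x))
    (\<lambda>x. (a * l * l) *\<^sub>R H (y + l *\<^sub>R x)) p (2 * p / (p + 1)) M"
proof -
  interpret solution_ball K u G H p "2 * p / (p + 1)" M by (rule sol)
  have a0: "0 < a" using a l by simp
  have inK: "y + l *\<^sub>R x \<in> ball 0 K" if "x \<in> ball 0 k" for x
  proof -
    have "dist y (y + l *\<^sub>R x) < l * k" using that l by (simp add: dist_norm)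
    then show ?thesis using sub by auto
  qed
  have aff: "((\<lambda>x. y + l *\<^sub>R x) has_derivative (\<lambda>h. l *\<^sub>R h)) (at x)" for x :: "real^'n"
    by (auto intro!: derivative_eq_intros)
  have pos: "positive_C2_ball k (\<lambda>x. a * u (y + l *\<^sub>R x)) (\<lambda>x. (a * l) *\<^sub>R G (y + l *\<^sub>R x))
    (\<lambda>x. (a * l * l) *\<^sub>R H (y + l *\<^sub>R x))"
  proof
    fix x :: "real^'n" assume x: "x \<in> ball 0 k"
    show "((\<lambda>x. a * u (y + l *\<^sub>R x)) has_derivative (\<lambda>h. ((a * l) *\<^sub>R G (y + l *\<^sub>R x)) \<bullet> h)) (at x)"
      using has_derivative_mult_right[OF has_derivative_compose[OF aff u_deriv[OF inK[OF x]]], of a]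
      by (simp add: mult.assoc)
    show "((\<lambda>x. (a * l) *\<^sub>R G (y + l *\<^sub>R x)) has_derivative (\<lambda>h. ((a * l * l) *\<^sub>R H (y + l *\<^sub>R x)) *v h)) (at x)"
      using has_derivative_scaleR_right[OF has_derivative_compose[OF aff G_deriv[OF inK[OF x]]], of "a * l"]
      by (simp add: matrix_vector_mult_scaleR scaleR_matrix_vector_assoc[symmetric] mult.assoc)
    show "((a * l * l) *\<^sub>R H (y + l *\<^sub>R x)) $ i $ j = ((a * l * l) *\<^sub>R H (y + l *\<^sub>R x)) $ j $ i" for i j
      using H_sym[OF inK[OF x], of i j] by simp
    show "0 < a * u (y + l *\<^sub>R x)" using u_pos[OF inK[OF x]] a0 by simp
  next
    have "continuous_on (ball 0 k) (\<lambda>x. H (y + l *\<^sub>R x))"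
      by (rule continuous_on_compose2[OF H_cont]) (use inK in \<open>auto intro!: continuous_intros\<close>)
    then show "continuous_on (ball 0 k) (\<lambda>x. (a * l * l) *\<^sub>R H (y + l *\<^sub>R x))"
      by (intro continuous_intros)
  qed
  interpret r: positive_C2_ball k "\<lambda>x. a * u (y + l *\<^sub>R x)" "\<lambda>x. (a * l) *\<^sub>R G (y + l *\<^sub>R x)"
    "\<lambda>x. (a * l * l) *\<^sub>R H (y + l *\<^sub>R x)" by (rule pos)
  show ?thesis
  proof
    fix x :: "real^'n" assume x: "x \<in> ball 0 k"
    define q where "q = 2 * p / (p + 1)"
    let ?y = "y + l *\<^sub>R x"
    have l2: "a * l * l = l powr (2 * p / (p - 1))"
    proof -
      have "a * l * l = l powr (2 / (p - 1)) * (l powr 1 * l powr 1)" using l a by simp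
      also have "\<dots> = l powr (2 / (p - 1) + 2)" unfolding powr_add[symmetric] by simp
      also have "2 / (p - 1) + 2 = 2 * p / (p - 1)" using p by (simp add: field_simps)
      finally show ?thesis .
    qed
    have ap: "a powr p = a * l * l" unfolding l2 unfolding a using l by (simp add: powr_powr)
    have aq: "(a * l) powr q = a * l * l"
    proof -
      have "a * l = l powr (2 / (p - 1)) * l powr 1" using l a by simp
      also have "\<dots> = l powr (2 / (p - 1) + 1)" unfolding powr_add[symmetric] by simp
      also have "2 / (p - 1) + 1 = (p + 1) / (p - 1)" using p by (simp add: field_simps)
      finally have "(a * l) powr q = l powr ((p + 1) / (p - 1) * q)" by (simp add: powr_powr)
      also have "(p + 1) / (p - 1) * q = 2 * p / (p - 1)" using p by (simp add: q_def)
      finally show ?thesis using l2 by simp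
    qed
    have "r.lap x = a * l * l * lap ?y"
      by (simp add: r.lap_def lap_def sum_distrib_left)
    then have "- r.lap x = a * l * l * (- lap ?y)" by simp
    also have "- lap ?y = u ?y powr p + M * norm (G ?y) powr q"
      unfolding q_def by (rule equation[OF inK[OF x]])
    also have "a * l * l * \<dots> = a * l * l * u ?y powr p + M * (a * l * l * norm (G ?y) powr q)"
      by (simp add: algebra_simps)
    also have "\<dots> = a powr p * u ?y powr p + M * ((a * l) powr q * norm (G ?y) powr q)"
      unfolding ap aq ..
    also have "\<dots> = (a * u ?y) powr p + M * norm ((a * l) *\<^sub>R G ?y) powr q"
      using a0 l by (simp add: powr_mult)
    finally show "- r.lap x = (a * u ?y) powr p + M * norm ((a * l) *\<^sub>R G ?y) powr (2 * p / (p + 1))"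
      by (simp add: q_def)
  qed
qed

lemma scaling_weight_rescale:
  fixes u :: "real^'n::finite \<Rightarrow> real"
  assumes "1 < p" "0 < l" "0 \<le> u (y + l *\<^sub>R x)" "a = l powr (2 / (p - 1))"
  shows "scaling_weight p (\<lambda>x. a * u (y + l *\<^sub>R x)) (\<lambda>x. (a * l) *\<^sub>R G (y + l *\<^sub>R x)) x
    = l * scaling_weight p u G (y + l *\<^sub>R x)"
proof -
  have "2 / (p - 1) * ((p - 1) / 2) = 1" using assms by simp
  then have 1: "a powr ((p - 1) / 2) = l" using assms(2,4) by (simp only: powr_powr powr_one)
  have "a * l = l powr (2 / (p - 1)) * l powr 1" using assms by simp
  also have "\<dots> = l powr (2 / (p - 1) + 1)" unfolding powr_add[symmetric] by simp
  also have "2 / (p - 1) + 1 = (p + 1) / (p - 1)" using assms by (simp add: field_simps)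
  finally have 2: "(a * l) powr ((p - 1) / (p + 1)) = l" using assms by (simp add: powr_powr)
  have a: "0 < a" using assms by simp
  then have "norm ((a * l) *\<^sub>R v) = (a * l) * norm v" for v :: "real^'n"
    using assms(2) by simp
  then show ?thesis
    by (simp only: scaling_weight_def powr_mult[of "a * l"] powr_mult[of a "u (y + l *\<^sub>R x)"] 1 2 distrib_left)
qed

lemma (in positive_C2_ball) lipschitz:
  assumes "\<And>x. x \<in> ball 0 K \<Longrightarrow> norm (G x) \<le> B" "x \<in> ball 0 K" "y \<in> ball 0 K"
  shows "\<bar>u x - u y\<bar> \<le> B * norm (x - y)"
proof -
  have "norm (u x - u y) \<le> B * norm (x - y)"
  proof (rule differentiable_bound[where S = "ball 0 K" and f' = "\<lambda>x h. G x \<bullet> h"])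
    show "(u has_derivative (\<bullet>) (G x)) (at x within ball 0 K)" if "x \<in> ball 0 K" for x
      using u_deriv[OF that] by (rule has_derivative_at_withinI)
    show "onorm ((\<bullet>) (G x)) \<le> B" if "x \<in> ball 0 K" for x
    proof (rule onorm_le)
      show "norm (G x \<bullet> h) \<le> B * norm h" for h
        using Cauchy_Schwarz_ineq2[of "G x" h] mult_right_mono[OF assms(1)[OF that], of "norm h"] by simp
    qed
  qed (use assms in auto)
  then show ?thesis by simp
qed

lemma powr_powr_cancel: "0 \<le> x \<Longrightarrow> b * c = 1 \<Longrightarrow> (x powr b) powr c = x" for x b c :: real
  by (simp add: powr_powr)

section \<open>Normalized solutions and doubling\<close>

lemma normalized_radius_bound:
  fixes p :: real
  assumes n3: "3 \<le> CARD('n::finite)"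
    and p: "1 < p" "p < (real CARD('n) + 2) / (real CARD('n) - 2)"
  obtains e k\<^sub>0 where "0 < e" "0 < k\<^sub>0"
    "\<And>M k (u :: real^'n \<Rightarrow> real) G H. \<bar>M\<bar> \<le> e \<Longrightarrow>
      solution_ball k u G H p (2 * p / (p + 1)) M \<Longrightarrow> 0 < k \<Longrightarrow>
      (\<And>x. x \<in> ball 0 k \<Longrightarrow> scaling_weight p u G x \<le> 2) \<Longrightarrow> scaling_weight p u G 0 = 1 \<Longrightarrow> k \<le> k\<^sub>0"
proof -
  define n where "n = real CARD('n)"
  have n: "3 \<le> n" using n3 by (simp add: n_def)
  obtain e s \<sigma> C where e: "0 < e" and s: "0 < s" and \<sigma>: "real CARD('n) < \<sigma>" and C: "0 < C"
    and est: "\<And>M k K (u :: real^'n \<Rightarrow> real) G H y \<rho> \<kappa>. \<bar>M\<bar> \<le> e \<Longrightarrow> 0 < k \<Longrightarrow> k < K \<Longrightarrow>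
      solution_ball K u G H p (2 * p / (p + 1)) M \<Longrightarrow> ball y \<rho> \<subseteq> ball 0 (k / 2) \<Longrightarrow> 0 < \<rho> \<Longrightarrow> 0 < \<kappa> \<Longrightarrow>
      (\<And>x. x \<in> ball y \<rho> \<Longrightarrow> \<kappa> \<le> u x) \<Longrightarrow>
      \<kappa> powr s * \<rho> ^ CARD('n) \<le> C * k powr (real CARD('n) - \<sigma>)"
    by (fact integral_estimate[OF n3 p])
  \<comment> \<open>\<open>Ub\<close> and \<open>Gb\<close> bound u and |grad u| where the weight is
    at most 2. The thresholds \<open>u0\<close> and \<open>g0\<close> below are attained by u(0) or
    |grad u(0)|, since one summand of a weight equal to 1 is at least 1/2.\<close>
  define Ub where "Ub = (2::real) powr (2 / (p - 1))"
  define Gb where "Gb = (2::real) powr ((p + 1) / (p - 1))"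
  define q where "q = 2 * p / (p + 1)"
  define Q where "Q = Ub powr p + Gb powr q"
  define g0 where "g0 = (1 / 2 :: real) powr ((p + 1) / (p - 1))"
  define u0 where "u0 = (1 / 2 :: real) powr (2 / (p - 1))"
  have pos: "0 < Ub" "0 < Gb" "0 < Q" "0 < g0" "0 < u0"
    by (auto simp: Ub_def Gb_def Q_def g0_def u0_def add_pos_pos)
  \<comment> \<open>\<open>r\<close> and \<open>U1\<close> make each of the two contributions to
    \<open>gradient_bound\<close>, n^2 U1/r and n Q r, at most g0/4. So u \<le> U1 on radius
    \<open>r\<close> would contradict |grad u(0)| \<ge> g0.\<close>
  define r where "r = min 1 (g0 / (4 * n * Q))"
  have r: "0 < r" "r \<le> 1" using pos n by (auto simp: r_def)
  have "n * Q * r \<le> n * Q * (g0 / (4 * n * Q))"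
    using pos n by (intro mult_left_mono) (auto simp: r_def)
  then have rQ: "n * Q * r \<le> g0 / 4" using pos n by simp
  define U1 where "U1 = g0 * r / (4 * n * n)"
  have U1: "0 < U1" using pos r n by (auto simp: U1_def intro!: divide_pos_pos mult_pos_pos)
  define \<kappa> where "\<kappa> = min U1 u0 / 2"
  have \<kappa>: "0 < \<kappa>" "2 * \<kappa> \<le> U1" "2 * \<kappa> \<le> u0" using U1 pos by (auto simp: \<kappa>_def)
  \<comment> \<open>With Lipschitz constant \<open>Gb\<close>, a value of at least 2\<kappa> stays
    above \<kappa> within distance \<rho>.\<close>
  define \<rho> where "\<rho> = min 1 (\<kappa> / Gb)"
  have \<rho>: "0 < \<rho>" "\<rho> \<le> 1" using \<kappa> pos by (auto simp: \<rho>_def)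
  have "Gb * \<rho> \<le> Gb * (\<kappa> / Gb)" using pos by (intro mult_left_mono) (auto simp: \<rho>_def)
  then have \<rho>G: "Gb * \<rho> \<le> \<kappa>" using pos by simp
  define X where "X = C / (\<kappa> powr s * \<rho> ^ CARD('n))"
  have X: "0 < X" using C \<kappa> \<rho> by (simp add: X_def)
  \<comment> \<open>k > 8 puts \<open>ball x0 \<rho>\<close>, which lies within radius 2, into the
    ball of radius k/4. The other entry solves (k/2)^(\<sigma>-n) \<le> X for k.\<close>
  define k\<^sub>0 where "k\<^sub>0 = max 8 (2 * X powr (1 / (\<sigma> - n)))"
  show ?thesis
  proof (rule that)
    show "0 < min e 1" "0 < k\<^sub>0" using e by (auto simp: k\<^sub>0_def)
    fix M k G H and u :: "real^'n \<Rightarrow> real"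
    assume M: "\<bar>M\<bar> \<le> min e 1" and sol: "solution_ball k u G H p (2 * p / (p + 1)) M" and k: "0 < k"
      and w2: "\<And>x. x \<in> ball 0 k \<Longrightarrow> scaling_weight p u G x \<le> 2" and w1: "scaling_weight p u G 0 = 1"
    interpret solution_ball k u G H p "2 * p / (p + 1)" M by (rule sol)
    show "k \<le> k\<^sub>0"
    proof (rule ccontr)
      assume "\<not> k \<le> k\<^sub>0"
      then have k8: "8 < k" and kX: "2 * X powr (1 / (\<sigma> - n)) < k" by (auto simp: k\<^sub>0_def)
      have Ub: "u x \<le> Ub" and Gb: "norm (G x) \<le> Gb" if "x \<in> ball 0 k" for x
      proof -
        have "u x powr ((p - 1) / 2) \<le> 2" "norm (G x) powr ((p - 1) / (p + 1)) \<le> 2"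
          using w2[OF that] by (simp_all add: scaling_weight_def)
           (meson add_decreasing add_increasing add_increasing2 order.trans powr_ge_zero order_refl)+
        then have "(u x powr ((p - 1) / 2)) powr (2 / (p - 1)) \<le> Ub"
          "(norm (G x) powr ((p - 1) / (p + 1))) powr ((p + 1) / (p - 1)) \<le> Gb"
          unfolding Ub_def Gb_def using p by (intro powr_mono2; simp)+
        then show "u x \<le> Ub" "norm (G x) \<le> Gb"
          using u_pos[OF that] p by (simp_all add: powr_powr_cancel del: powr_powr)
      qed
      have lapQ: "\<bar>lap x\<bar> \<le> Q" if x: "x \<in> ball 0 k" for x
      proof -
        have "\<bar>lap x\<bar> = \<bar>u x powr p + M * norm (G x) powr q\<bar>"
          using equation[OF x] by (simp add: q_def)
        also have "\<dots> \<le> u x powr p + \<bar>M\<bar> * norm (G x) powr q"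
          using abs_triangle_ineq[of "u x powr p" "M * norm (G x) powr q"] by (simp add: abs_mult)
        also have "\<dots> \<le> Ub powr p + 1 * Gb powr q"
          using M Ub[OF x] Gb[OF x] u_pos[OF x] p
          by (intro add_mono mult_mono powr_mono2) (auto simp: q_def)
        finally show ?thesis by (simp add: Q_def)
      qed
      obtain x0 where x0: "norm x0 \<le> 1" "2 * \<kappa> \<le> u x0"
      proof (cases "1 / 2 \<le> u 0 powr ((p - 1) / 2)")
        case True
        then have "u0 \<le> (u 0 powr ((p - 1) / 2)) powr (2 / (p - 1))"
          unfolding u0_def using p by (intro powr_mono2) auto
        then have "u0 \<le> u 0" using u_pos[of 0] k p by (simp add: powr_powr_cancel del: powr_powr)
        then show ?thesis using that[of 0] \<kappa> by simp
      next
        case False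
        then have "1 / 2 \<le> norm (G 0) powr ((p - 1) / (p + 1))"
          using w1 by (simp add: scaling_weight_def)
        then have "g0 \<le> (norm (G 0) powr ((p - 1) / (p + 1))) powr ((p + 1) / (p - 1))"
          unfolding g0_def using p by (intro powr_mono2) auto
        then have G0: "g0 \<le> norm (G 0)" using p by (simp add: powr_powr_cancel del: powr_powr)
        have "\<exists>x. norm x \<le> r \<and> U1 < u x"
        proof (rule ccontr)
          assume "\<not> ?thesis"
          then have "norm (G 0) \<le> n * (n * U1 / r + Q * r)"
            unfolding n_def using r k8 lapQ by (intro gradient_bound) (auto simp: not_less)
          also have "\<dots> = g0 / 4 + n * Q * r"
            using n r by (simp add: U1_def algebra_simps)
          also have "\<dots> < g0" using rQ pos by linarith
          finally show False using G0 by simp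
        qed
        then obtain x where "norm x \<le> r" "U1 < u x" by blast
        then show ?thesis using that[of x] r \<kappa> by simp
      qed
      have sub: "ball x0 \<rho> \<subseteq> ball 0 (k / 2 / 2)"
      proof
        fix x assume "x \<in> ball x0 \<rho>"
        then have "norm (x - x0) < 1" using \<rho> by (simp add: dist_norm norm_minus_commute)
        then show "x \<in> ball 0 (k / 2 / 2)"
          using norm_triangle_ineq[of "x - x0" x0] x0 k8 by simp
      qed
      have low: "\<kappa> \<le> u x" if x: "x \<in> ball x0 \<rho>" for x
      proof -
        have "x \<in> ball 0 k" "x0 \<in> ball 0 k" using sub x x0 k8 by auto
        then have "\<bar>u x0 - u x\<bar> \<le> Gb * norm (x0 - x)" by (intro lipschitz Gb)
        also have "\<dots> \<le> Gb * \<rho>" using x pos by (intro mult_left_mono) (auto simp: dist_norm)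
        finally show ?thesis using \<rho>G x0 by linarith
      qed
      \<comment> \<open>The cutoff radius is k/2, since \<open>integral_estimate\<close> wants it
        strictly below the radius of the ball of the solution.\<close>
      have "\<kappa> powr s * \<rho> ^ CARD('n) \<le> C * (k / 2) powr (n - \<sigma>)"
        unfolding n_def by (rule est[OF _ _ _ sol sub]) (use M k \<rho> \<kappa> low in auto)
      moreover have "(k / 2) powr (n - \<sigma>) = 1 / (k / 2) powr (\<sigma> - n)"
        using powr_minus_divide[of "k / 2" "\<sigma> - n"] by simp
      ultimately have "(k / 2) powr (\<sigma> - n) \<le> X"
        using k \<kappa> \<rho> by (simp add: X_def field_simps)
      then have "((k / 2) powr (\<sigma> - n)) powr (1 / (\<sigma> - n)) \<le> X powr (1 / (\<sigma> - n))"
        using \<sigma> by (intro powr_mono2) (auto simp: n_def)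
      then have "k / 2 \<le> X powr (1 / (\<sigma> - n))" using k \<sigma> by (simp add: powr_powr n_def)
      then show False using kX by simp
    qed
  qed
qed

text \<open>The doubling argument: at a maximum \<open>y\<close> of \<open>(R' - |x|) w(x)\<close> the weight is at most doubled on
  the ball of half the distance from \<open>y\<close> to the boundary, so rescaling by \<open>1 / w(y)\<close> normalizes it.\<close>

lemma scaling_weight_bound:
  fixes p :: real
  assumes n3: "3 \<le> CARD('n::finite)"
    and p: "1 < p" "p < (real CARD('n) + 2) / (real CARD('n) - 2)"
  obtains e K\<^sub>0 where "0 < e" "0 < K\<^sub>0"
    "\<And>M R (u :: real^'n \<Rightarrow> real) G H. \<bar>M\<bar> \<le> e \<Longrightarrow> 0 < R \<Longrightarrow>
      solution_ball R u G H p (2 * p / (p + 1)) M \<Longrightarrow> R * scaling_weight p u G 0 \<le> K\<^sub>0"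
proof -
  obtain e k\<^sub>0 where e: "0 < e" and k0: "0 < k\<^sub>0" and norm_bound:
    "\<And>M k (u :: real^'n \<Rightarrow> real) G H. \<bar>M\<bar> \<le> e \<Longrightarrow>
      solution_ball k u G H p (2 * p / (p + 1)) M \<Longrightarrow> 0 < k \<Longrightarrow>
      (\<And>x. x \<in> ball 0 k \<Longrightarrow> scaling_weight p u G x \<le> 2) \<Longrightarrow> scaling_weight p u G 0 = 1 \<Longrightarrow> k \<le> k\<^sub>0"
    by (fact normalized_radius_bound[OF n3 p])
  show ?thesis
  proof (rule that)
    show "0 < e" "0 < 2 * k\<^sub>0" using e k0 by auto
    fix M R G H and u :: "real^'n \<Rightarrow> real"
    assume M: "\<bar>M\<bar> \<le> e" and R: "0 < R" and sol: "solution_ball R u G H p (2 * p / (p + 1)) M"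
    interpret solution_ball R u G H p "2 * p / (p + 1)" M by (rule sol)
    define w where "w = scaling_weight p u G"
    have w_pos: "0 < w x" if "x \<in> ball 0 R" for x
      using u_pos[OF that] by (simp add: w_def scaling_weight_def add_pos_nonneg)
    have w_cont: "continuous_on (ball 0 R) w"
    proof -
      have "continuous_on (ball 0 R) (\<lambda>x. norm (G x) powr ((p - 1) / (p + 1)))"
        using p by (intro continuous_on_powr' continuous_intros G_cont) auto
      then show ?thesis
        unfolding w_def scaling_weight_def by (intro continuous_on_add u_powr_cont)
    qed
    \<comment> \<open>The weight may be unbounded near the sphere of radius R, so the maximum is
      taken over a smaller closed ball. The bound is uniform in \<open>R'\<close>, which afterwards
      tends to \<open>R\<close>.\<close>
    have *: "R' * w 0 \<le> 2 * k\<^sub>0" if R': "0 < R'" "R' < R" for R'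
    proof -
      have sub: "cball 0 R' \<subseteq> (ball 0 R :: (real^'n) set)" using R' by auto
      have "continuous_on (cball 0 R') (\<lambda>x. (R' - norm x) * w x)"
        by (intro continuous_intros continuous_on_subset[OF w_cont sub])
      then obtain y where y: "y \<in> cball 0 R'"
        and ymax: "\<And>x. x \<in> cball 0 R' \<Longrightarrow> (R' - norm x) * w x \<le> (R' - norm y) * w y"
        using continuous_attains_sup[of "cball 0 R'" "\<lambda>x. (R' - norm x) * w x"] R' by auto
      have F0: "R' * w 0 \<le> (R' - norm y) * w y" using ymax[of 0] R' by simp
      have wy: "0 < w y" using y sub by (intro w_pos) auto
      have "0 < R' * w 0" using w_pos[of 0] R' by simp
      with F0 have "0 < (R' - norm y) * w y" by linarith
      then have d0: "0 < R' - norm y" using wy by (simp add: zero_less_mult_iff)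
      define d where "d = (R' - norm y) / 2"
      define l where "l = 1 / w y"
      define k where "k = d * w y"
      define a where "a = l powr (2 / (p - 1))"
      have d: "0 < d" using d0 by (simp add: d_def)
      have l: "0 < l" "l * k = d" "l * w y = 1" using wy by (auto simp: l_def k_def)
      have near: "norm x \<le> R' - d" if "x \<in> ball y d" for x
      proof -
        have "norm (x - y) < d" using that by (simp add: dist_norm norm_minus_commute)
        then show ?thesis using norm_triangle_ineq[of "x - y" y] by (simp add: d_def field_simps)
      qed
      have subd: "ball y (l * k) \<subseteq> ball 0 R" using near d R' l by fastforce
      have up: "w x \<le> 2 * w y" if "x \<in> ball y d" for x
      proof -
        have "d * w x \<le> (R' - norm x) * w x"
          using near[OF that] w_pos[of x] d R' by (intro mult_right_mono) auto
        also have "\<dots> \<le> (R' - norm y) * w y"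
          using near[OF that] d by (intro ymax) simp
        also have "\<dots> = 2 * d * w y" by (simp add: d_def)
        finally show ?thesis using d by simp
      qed
      have rs: "scaling_weight p (\<lambda>x. a * u (y + l *\<^sub>R x)) (\<lambda>x. (a * l) *\<^sub>R G (y + l *\<^sub>R x)) x
          = l * w (y + l *\<^sub>R x)" if "x \<in> ball 0 k" for x
      proof -
        have "y + l *\<^sub>R x \<in> ball y (l * k)" using that l(1) by (simp add: dist_norm)
        then show ?thesis
          unfolding w_def using subd u_pos[of "y + l *\<^sub>R x"]
          by (intro scaling_weight_rescale p l a_def) (auto intro: less_imp_le)
      qed
      have "k \<le> k\<^sub>0"
      proof (rule norm_bound[OF M solution_ball_rescale[OF sol p(1) l(1) subd a_def]])
        show "0 < k" using d wy by (simp add: k_def)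
        then show "scaling_weight p (\<lambda>x. a * u (y + l *\<^sub>R x)) (\<lambda>x. (a * l) *\<^sub>R G (y + l *\<^sub>R x)) 0 = 1"
          using rs[of 0] l by simp
        fix x :: "real^'n" assume x: "x \<in> ball 0 k"
        then have "y + l *\<^sub>R x \<in> ball y (l * k)" using l(1) by (simp add: dist_norm)
        then have "l * w (y + l *\<^sub>R x) \<le> l * (2 * w y)" using l up by (intro mult_left_mono) auto
        also have "\<dots> = 2" using l(3) by (simp add: mult.left_commute)
        finally show "scaling_weight p (\<lambda>x. a * u (y + l *\<^sub>R x)) (\<lambda>x. (a * l) *\<^sub>R G (y + l *\<^sub>R x)) x \<le> 2"
          using rs[OF x] by simp
      qed
      then show ?thesis using F0 by (simp add: k_def d_def)
    qed
    have "R \<le> 2 * k\<^sub>0 / w 0"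
    proof (rule dense_le_bounded[OF R])
      fix R' assume "0 < R'" "R' < R"
      then show "R' \<le> 2 * k\<^sub>0 / w 0" using * w_pos[of 0] R by (simp add: field_simps)
    qed
    then show "R * scaling_weight p u G 0 \<le> 2 * k\<^sub>0"
      using w_pos[of 0] R by (simp add: field_simps w_def)
  qed
qed

section \<open>From classical solutions on a set to solutions on balls about the origin\<close>

lemma has_derivative_gradient:
  fixes u :: "real^'n::finite \<Rightarrow> real"
  assumes "u differentiable at x"
  shows "(u has_derivative (\<lambda>h. gradient u x \<bullet> h)) (at x)"
proof -
  obtain f' where f': "(u has_derivative f') (at x)"
    using assms by (auto simp: differentiable_def)
  interpret bounded_linear f' using f' by (rule has_derivative_bounded_linear)
  have "f' h = gradient u x \<bullet> h" for h
  proof -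
    have "f' h = f' (\<Sum>i\<in>UNIV. (h $ i) *\<^sub>R axis i 1)"
      using basis_expansion[of h] by (simp add: scalar_mult_eq_scaleR)
    also have "\<dots> = (\<Sum>i\<in>UNIV. h $ i * f' (axis i 1))" by (simp add: sum scaleR)
    also have "\<dots> = gradient u x \<bullet> h"
      using has_pderiv_imp_partial_deriv[OF has_pderiv_of_derivative[OF f']]
      by (simp add: gradient_def inner_vec_def mult.commute)
    finally show ?thesis .
  qed
  then have "f' = (\<lambda>h. gradient u x \<bullet> h)" by auto
  then show ?thesis using f' by simp
qed

text \<open>Translation puts the point of interest at the origin. The symmetry of \<open>H\<close>
  comes from Schwarz's theorem on a small ball inside \<open>S\<close>, and positivity turns
  |u|^(p-1) u into u^p.\<close>

lemma positive_solution_imp_solution_ball: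
  fixes u :: "real^'n::finite \<Rightarrow> real"
  assumes sol: "positive_solution p q M S u" and sub: "ball y R \<subseteq> S"
  shows "solution_ball R (\<lambda>x. u (y + x)) (\<lambda>x. gradient u (y + x))
    (\<lambda>x. \<chi> i j. partial_deriv j (partial_deriv i u) (y + x)) p q M"
proof -
  let ?H = "\<lambda>x. (\<chi> i j. partial_deriv j (partial_deriv i u) x) :: real^'n^'n"
  have C2: "\<And>x. x \<in> S \<Longrightarrow> u differentiable at x"
    "\<And>i x. x \<in> S \<Longrightarrow> partial_deriv i u differentiable at x"
    "\<And>i j. continuous_on S (partial_deriv j (partial_deriv i u))"
    and eq: "\<And>x. x \<in> S \<Longrightarrow> 0 < u x"
    "\<And>x. x \<in> S \<Longrightarrow> - laplacian u x = \<bar>u x\<bar> powr (p - 1) * u x + M * norm (gradient u x) powr q"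
    using sol by (auto simp: positive_solution_def C2_on_def)
  have inS: "y + x \<in> S" if "x \<in> ball 0 R" for x using that sub by (auto simp: dist_norm)
  have shift: "((\<lambda>x. y + x) has_derivative (\<lambda>h. h)) (at x)" for x :: "real^'n"
    by (auto intro!: derivative_eq_intros)
  have first: "has_pderiv i u (partial_deriv i u x) x" if "x \<in> S" for i x
    using has_pderiv_of_derivative[OF has_derivative_gradient[OF C2(1)[OF that]], of i]
    by (simp add: inner_axis gradient_def)
  have second: "has_pderiv j (partial_deriv i u) (partial_deriv j (partial_deriv i u) x) x" if "x \<in> S" for i j x
    using has_pderiv_of_derivative[OF has_derivative_gradient[OF C2(2)[OF that]], of j]
    by (simp add: inner_axis gradient_def)
  have pos: "positive_C2_ball R (\<lambda>x. u (y + x)) (\<lambda>x. gradient u (y + x)) (\<lambda>x. ?H (y + x))"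
  proof
    fix x :: "real^'n" assume x: "x \<in> ball 0 R"
    show "((\<lambda>x. u (y + x)) has_derivative (\<lambda>h. gradient u (y + x) \<bullet> h)) (at x)"
      using has_derivative_compose[OF shift has_derivative_gradient[OF C2(1)[OF inS[OF x]]]] by simp
    have "(gradient u has_derivative (\<lambda>h. ?H (y + x) *v h)) (at (y + x))"
    proof (subst has_derivative_componentwise_within, intro ballI)
      fix b :: "real^'n" assume "b \<in> Basis"
      then obtain i where b: "b = axis i 1" by (auto simp: Basis_vec_def)
      have "(?H (y + x) *v h) $ i = gradient (partial_deriv i u) (y + x) \<bullet> h" for h
        by (simp add: matrix_vector_mult_def inner_vec_def gradient_def)
      then show "((\<lambda>x. gradient u x \<bullet> b) has_derivative (\<lambda>h. (?H (y + x) *v h) \<bullet> b)) (at (y + x))"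
        using has_derivative_gradient[OF C2(2)[OF inS[OF x]], of i]
        by (simp add: b inner_axis) (simp add: gradient_def)
    qed
    from has_derivative_compose[OF shift this]
    show "((\<lambda>x. gradient u (y + x)) has_derivative (\<lambda>h. ?H (y + x) *v h)) (at x)" by simp
    obtain r where r: "0 < r" "ball (y + x) r \<subseteq> S"
    proof
      show "0 < R - norm x" using x by simp
      show "ball (y + x) (R - norm x) \<subseteq> S"
      proof
        fix z assume "z \<in> ball (y + x) (R - norm x)"
        then have "dist (y + x) z < R - norm x" by simp
        moreover have "dist y z \<le> dist y (y + x) + dist (y + x) z" by (rule dist_triangle)
        moreover have "dist y (y + x) = norm x" by (simp add: dist_norm)
        ultimately have "z \<in> ball y R" by simp
        then show "z \<in> S" using sub by blast
      qed
    qed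
    have "partial_deriv j (partial_deriv i u) (y + x) = partial_deriv i (partial_deriv j u) (y + x)" for i j
      by (rule symmetric_second_pderiv[OF r(1) first first second second])
        (use r(2) in \<open>auto intro: continuous_on_subset[OF C2(3)]\<close>)
    then show "?H (y + x) $ i $ j = ?H (y + x) $ j $ i" for i j by simp
    show "0 < u (y + x)" using eq(1) inS x by blast
  next
    have "continuous_on S ?H" by (intro continuous_on_vec_lambda C2)
    then show "continuous_on (ball 0 R) (\<lambda>x. ?H (y + x))"
    proof (rule continuous_on_compose2)
      show "(\<lambda>x. y + x) ` ball 0 R \<subseteq> S" using inS by blast
    qed (intro continuous_intros)
  qed
  interpret positive_C2_ball R "\<lambda>x. u (y + x)" "\<lambda>x. gradient u (y + x)" "\<lambda>x. ?H (y + x)" by (rule pos)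
  show ?thesis
  proof
    fix x :: "real^'n" assume x: "x \<in> ball 0 R"
    have "lap x = laplacian u (y + x)" by (simp add: lap_def laplacian_def)
    moreover have "\<bar>u (y + x)\<bar> powr (p - 1) * u (y + x) = u (y + x) powr p"
      using eq(1)[OF inS[OF x]] by (simp add: powr_diff)
    ultimately show "- lap x = u (y + x) powr p + M * norm (gradient u (y + x)) powr q"
      using eq(2)[OF inS[OF x]] by simp
  qed
qed

text \<open>The power 2/(p-1) of the two summands of the weight is u and |grad u|^(2/(p+1)), and it
  turns K0/R into the required power of R. The set \<open>S\<close> enters only through a ball that
  it contains.\<close>

lemma local_estimate:
  fixes p :: real
  assumes n3: "3 \<le> CARD('n::finite)"
    and p: "1 < p" "p < (real CARD('n) + 2) / (real CARD('n) - 2)"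
  obtains e C where "0 < e" "0 < C"
    "\<And>M R S y (u :: real^'n \<Rightarrow> real). \<bar>M\<bar> \<le> e \<Longrightarrow> 0 < R \<Longrightarrow> ball y R \<subseteq> S \<Longrightarrow>
      positive_solution p (2 * p / (p + 1)) M S u \<Longrightarrow>
      u y + norm (gradient u y) powr (2 / (p + 1)) \<le> C * R powr (- (2 / (p - 1)))"
proof -
  obtain e K\<^sub>0 where e: "0 < e" and K0: "0 < K\<^sub>0" and bound:
    "\<And>M R (u :: real^'n \<Rightarrow> real) G H. \<bar>M\<bar> \<le> e \<Longrightarrow> 0 < R \<Longrightarrow>
      solution_ball R u G H p (2 * p / (p + 1)) M \<Longrightarrow> R * scaling_weight p u G 0 \<le> K\<^sub>0"
    by (fact scaling_weight_bound[OF n3 p])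
  show ?thesis
  proof (rule that[OF e])
    show "0 < 2 * K\<^sub>0 powr (2 / (p - 1))" using K0 by simp
    fix M R S y and u :: "real^'n \<Rightarrow> real"
    assume M: "\<bar>M\<bar> \<le> e" and R: "0 < R" and sub: "ball y R \<subseteq> S"
      and sol: "positive_solution p (2 * p / (p + 1)) M S u"
    have "y \<in> S" using sub R centre_in_ball by blast
    then have uy: "0 < u y" using sol by (simp add: positive_solution_def)
    let ?g = "norm (gradient u y)"
    have "R * (u y powr ((p - 1) / 2) + ?g powr ((p - 1) / (p + 1))) \<le> K\<^sub>0"
      using bound[OF M R positive_solution_imp_solution_ball[OF sol sub]]
      by (simp add: scaling_weight_def)
    then have "u y powr ((p - 1) / 2) + ?g powr ((p - 1) / (p + 1)) \<le> K\<^sub>0 / R"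
      using R by (simp add: field_simps)
    moreover have "0 \<le> u y powr ((p - 1) / 2)" "0 \<le> ?g powr ((p - 1) / (p + 1))" by auto
    ultimately have "u y powr ((p - 1) / 2) \<le> K\<^sub>0 / R" "?g powr ((p - 1) / (p + 1)) \<le> K\<^sub>0 / R"
      by linarith+
    then have "(u y powr ((p - 1) / 2)) powr (2 / (p - 1)) \<le> (K\<^sub>0 / R) powr (2 / (p - 1))"
      and "(?g powr ((p - 1) / (p + 1))) powr (2 / (p - 1)) \<le> (K\<^sub>0 / R) powr (2 / (p - 1))"
      using p by (intro powr_mono2; simp)+
    moreover have "(u y powr ((p - 1) / 2)) powr (2 / (p - 1)) = u y"
      using uy p by (intro powr_powr_cancel) auto
    moreover have "(p - 1) / (p + 1) * (2 / (p - 1)) = 2 / (p + 1)" using p by (simp add: divide_simps)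
    then have "(?g powr ((p - 1) / (p + 1))) powr (2 / (p - 1)) = ?g powr (2 / (p + 1))"
      by (simp only: powr_powr)
    moreover have "(K\<^sub>0 / R) powr (2 / (p - 1)) = K\<^sub>0 powr (2 / (p - 1)) * R powr (- (2 / (p - 1)))"
      using K0 R by (simp add: powr_divide powr_minus_divide)
    ultimately show "u y + ?g powr (2 / (p + 1)) \<le> 2 * K\<^sub>0 powr (2 / (p - 1)) * R powr (- (2 / (p - 1)))"
      by simp
  qed
qed

section \<open>Punctured balls, the whole space and general domains as instances of the local
  estimate\<close>

theorem theoremE:
  fixes p q :: real
  assumes "CARD('n::finite) \<ge> 3"
    and "1 < p" and "p < (real CARD('n) + 2) / (real CARD('n) - 2)"
    and "q = 2 * p / (p + 1)"
  shows "\<exists>\<epsilon>\<^sub>0>0.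
    (\<exists>c>0. \<forall>M R. \<forall>u :: real^'n \<Rightarrow> real.
       \<bar>M\<bar> \<le> \<epsilon>\<^sub>0 \<longrightarrow> 0 < R \<longrightarrow> positive_solution p q M (ball 0 R - {0}) u \<longrightarrow>
       (\<forall>x \<in> ball 0 (R / 2) - {0}. u x \<le> c * norm x powr (- (2 / (p - 1))))) \<and>
    (\<forall>M. \<bar>M\<bar> \<le> \<epsilon>\<^sub>0 \<longrightarrow>
       \<not> (\<exists>u :: real^'n \<Rightarrow> real. positive_solution p q M UNIV u)) \<and>
    (\<exists>c'>0. \<forall>M. \<forall>\<Omega> :: (real^'n) set. \<forall>u :: real^'n \<Rightarrow> real.
       \<bar>M\<bar> \<le> \<epsilon>\<^sub>0 \<longrightarrow> open \<Omega> \<longrightarrow> connected \<Omega> \<longrightarrow> frontier \<Omega> \<noteq> {} \<longrightarrow>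
       positive_solution p q M \<Omega> u \<longrightarrow>
       (\<forall>x\<in>\<Omega>. u x + norm (gradient u x) powr (2 / (p + 1))
                \<le> c' * infdist x (frontier \<Omega>) powr (- (2 / (p - 1)))))"
proof -
  obtain e C where e: "0 < e" and C: "0 < C" and est:
    "\<And>M R S y (u :: real^'n \<Rightarrow> real). \<bar>M\<bar> \<le> e \<Longrightarrow> 0 < R \<Longrightarrow> ball y R \<subseteq> S \<Longrightarrow>
      positive_solution p (2 * p / (p + 1)) M S u \<Longrightarrow>
      u y + norm (gradient u y) powr (2 / (p + 1)) \<le> C * R powr (- (2 / (p - 1)))"
    by (fact local_estimate[OF assms(1-3)])
  note est = est[folded assms(4)]
  show ?thesis
  proof (rule exI[of _ e], intro conjI)
    show "\<exists>c>0. \<forall>M R. \<forall>u :: real^'n \<Rightarrow> real.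
       \<bar>M\<bar> \<le> e \<longrightarrow> 0 < R \<longrightarrow> positive_solution p q M (ball 0 R - {0}) u \<longrightarrow>
       (\<forall>x \<in> ball 0 (R / 2) - {0}. u x \<le> c * norm x powr (- (2 / (p - 1))))"
    proof (intro exI[of _ C] conjI allI impI ballI)
      fix M R and x :: "real^'n" and u :: "real^'n \<Rightarrow> real"
      assume M: "\<bar>M\<bar> \<le> e" and sol: "positive_solution p q M (ball 0 R - {0}) u"
        and x: "x \<in> ball 0 (R / 2) - {0}"
      \<comment> \<open>The ball of radius |x| about \<open>x\<close> is the largest one that avoids
        the origin; it lies within radius 2|x| < R.\<close>
      have "ball x (norm x) \<subseteq> ball 0 R - {0}"
      proof
        fix z assume "z \<in> ball x (norm x)"
        then have "norm (z - x) < norm x" by (simp add: dist_norm norm_minus_commute)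
        then show "z \<in> ball 0 R - {0}"
          using norm_triangle_ineq[of "z - x" x] x by auto
      qed
      from est[OF M _ this sol] x
      have "u x + norm (gradient u x) powr (2 / (p + 1)) \<le> C * norm x powr (- (2 / (p - 1)))" by simp
      moreover have "0 \<le> norm (gradient u x) powr (2 / (p + 1))" by simp
      ultimately show "u x \<le> C * norm x powr (- (2 / (p - 1)))" by linarith
    qed (rule C)
    show "\<forall>M. \<bar>M\<bar> \<le> e \<longrightarrow> \<not> (\<exists>u :: real^'n \<Rightarrow> real. positive_solution p q M UNIV u)"
    proof (intro allI impI notI)
      fix M assume M: "\<bar>M\<bar> \<le> e" and "\<exists>u :: real^'n \<Rightarrow> real. positive_solution p q M UNIV u"
      then obtain u :: "real^'n \<Rightarrow> real" where sol: "positive_solution p q M UNIV u" by blast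
      have u0: "0 < u 0" using sol by (simp add: positive_solution_def)
      \<comment> \<open>On the whole space every radius is admissible, so u(0) lies below a quantity
        that tends to 0.\<close>
      have "((\<lambda>R. C * R powr (- (2 / (p - 1)))) \<longlongrightarrow> C * 0) at_top"
        by (intro tendsto_intros tendsto_neg_powr filterlim_ident) (use assms in simp)
      moreover have "\<forall>\<^sub>F R in at_top. u 0 \<le> C * R powr (- (2 / (p - 1)))"
        using eventually_gt_at_top[of 0]
      proof eventually_elim
        case (elim R)
        have "0 \<le> norm (gradient u 0) powr (2 / (p + 1))" by simp
        then show ?case using est[OF M elim subset_UNIV sol, of 0] by linarith
      qed
      ultimately have "u 0 \<le> C * 0"
        by (intro tendsto_lowerbound) auto
      then show False using u0 by simp
    qed
    show "\<exists>c'>0. \<forall>M. \<forall>\<Omega> :: (real^'n) set. \<forall>u :: real^'n \<Rightarrow> real.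
       \<bar>M\<bar> \<le> e \<longrightarrow> open \<Omega> \<longrightarrow> connected \<Omega> \<longrightarrow> frontier \<Omega> \<noteq> {} \<longrightarrow>
       positive_solution p q M \<Omega> u \<longrightarrow>
       (\<forall>x\<in>\<Omega>. u x + norm (gradient u x) powr (2 / (p + 1))
                \<le> c' * infdist x (frontier \<Omega>) powr (- (2 / (p - 1))))"
    proof (intro exI[of _ C] conjI allI impI ballI)
      fix M and x :: "real^'n" and \<Omega> :: "(real^'n) set" and u :: "real^'n \<Rightarrow> real"
      assume M: "\<bar>M\<bar> \<le> e" and \<Omega>: "open \<Omega>" "frontier \<Omega> \<noteq> {}"
        and sol: "positive_solution p q M \<Omega> u" and x: "x \<in> \<Omega>"
      let ?r = "infdist x (frontier \<Omega>)"
      have "x \<notin> frontier \<Omega>" using \<Omega>(1) x by (simp add: frontier_def interior_open)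
      \<comment> \<open>This is where a nonempty frontier matters: \<open>infdist\<close> to the
        empty set is 0 by default.\<close>
      then have r: "0 < ?r" using \<Omega>(2) by (simp add: infdist_pos_not_in_closed frontier_closed)
      \<comment> \<open>A ball is connected, so one that meets both \<Omega> and its complement
        meets the frontier, at distance less than \<open>?r\<close> from \<open>x\<close>.\<close>
      have "ball x ?r \<subseteq> \<Omega>"
      proof (rule ccontr)
        assume "\<not> ?thesis"
        moreover have "x \<in> ball x ?r \<inter> \<Omega>" using x r by simp
        ultimately have "ball x ?r \<inter> frontier \<Omega> \<noteq> {}"
          by (intro connected_Int_frontier) (simp, blast, blast)
        then obtain z where "z \<in> frontier \<Omega>" "dist x z < ?r" by auto
        then show False using infdist_le[of z "frontier \<Omega>" x] by simp
      qed
      from est[OF M r this sol]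
      show "u x + norm (gradient u x) powr (2 / (p + 1)) \<le> C * ?r powr (- (2 / (p - 1)))" .
    qed (rule C)
  qed (rule e)
qed

end
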